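(* For any matrix $A\in\mathbb{R}_{\max}^{n\times n}$, there are some matrices $C_i,S_i,R_i$ defined by induction (by iterating the process of weak CSR expansion), with each $S_i$ diagonally similar to a Boolean periodic matrix, and some scalars $\lambda_i\in\mathbb{R}$, where $i$ varies between $1$ and $K\le n$, such that $$A^t=\bigoplus_{i=1}^K\lambda_i^{\otimes t}\otimes C_iS_i^tR_i\qquad\text{for all } t\ge\min\big(\mathrm{Wi}(n),\ (n-2)\,\mathrm{cr}(\mathcal D(A))+n\big).$$
   Context: Max-plus conventions: $\mathbb{R}_{\max}=\mathbb{R}\cup\{-\infty\}$ with $a\oplus b=\max(a,b)$, $a\otimes b=a+b$, $\lambda^{\otimes t}=t\lambda$; matrix sums, products and powers are max-plus. $\mathcal D(A)$ is the digraph with nodes $1,\dots,n$ and an edge $(i,j)$ of weight $a_{ij}$ whenever $a_{ij}\ne-\infty$. A cycle is a closed walk of positive length with no repeated node except start $=$ end; $\lambda(A)$ is the maximal mean weight (sum of edge weights divided by number of edges) of a cycle, and the critical graph $\mathcal G^c(A)$ consists of the nodes and edges lying on cycles of mean $\lambda(A)$. s.c.c. = strongly connected component. The cyclicity of a strongly connected digraph is the gcd of the lengths of its closed walks; of a general digraph it is the lcm of the cyclicities of its s.c.c.'s. A representing subgraph of $\mathcal G^c(A)$ is a subgraph having no edges between its distinct s.c.c.'s and such that every s.c.c. of $\mathcal G^c(A)$ contains exactly one s.c.c. of it. CSR terms of $A$ with respect to a subgraph $\mathcal G$ of $\mathcal G^c(A)$ without trivial (edgeless) s.c.c.: let $\gamma$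 be the cyclicity of $\mathcal G$, $\bar A$ the matrix with entries $a_{ij}-\lambda(A)$, $M=(\bar A^{\gamma})^*$ with $X^*=\bigoplus_{k\ge0}X^k$. Then $c_{ij}=m_{ij}$ if $j$ is a node of $\mathcal G$, else $-\infty$; $r_{ij}=m_{ij}$ if $i$ is a node of $\mathcal G$, else $-\infty$; $s_{ij}=\bar a_{ij}$ if $(i,j)$ is an edge of $\mathcal G$, else $-\infty$. A weak CSR expansion of $A$ is an expansion $A^t=(\lambda(A)^{\otimes t}\otimes CS^tR)\oplus B^t$, valid for all large enough $t$, where $C,S,R$ are CSR terms with respect to some representing subgraph of $\mathcal G^c(A)$, and $B$ is obtained from $A$ by setting entries to $-\infty$ so that $\mathcal D(B)$ is disjoint from $\mathcal G^c(A)$. Iterating means expanding $B^t$ again in the same way, and so on. A Boolean matrix has entries in $\{-\infty,0\}$; it is periodic if its sequence of powers is periodic. $S$ is diagonally similar to $P$ if $p_{ij}=-x_i+s_{ij}+x_j$ for some $x\in\mathbb{R}^n$. $\mathrm{Wi}(1)=0$, $\mathrm{Wi}(n)=(n-1)^2+1$ for $n>1$; $\mathrm{cr}$ = greatest length of a cycle.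
   Formalization: The identity at t = 0 is claimed only if D(A) has a cycle; this excludes only n = 1, A = (−∞), t = 0, where the bound is 0, A^0 = (0), but no CSR expansion exists (λ(A) = −∞), so the sum is empty and equals −∞. *)

theory Defs
  imports "HOL-Analysis.Analysis" "Graph_Theory.Digraph_Component"
begin

section \<open>The max-plus semiring\<close>

datatype rmax = MInf | Fin (the_real: real)

text \<open>
  The semiring notation is max-plus: \<open>x + y\<close> is the maximum and \<open>x * y\<close> the ordinary sum, so
  \<open>0\<close> is \<open>-\<infinity>\<close>, \<open>1\<close> is the real number zero, and \<open>Fin l ^ t\<close> is \<open>Fin (t * l)\<close>.  With this
  instance the matrix product \<open>(**)\<close>, the unit \<open>mat 1\<close> and the sums of HOL-Analysis matrices are
  the max-plus ones.
\<close>

instantiation rmax :: linorder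
begin

fun less_eq_rmax :: "rmax \<Rightarrow> rmax \<Rightarrow> bool" where
  "less_eq_rmax MInf y = True"
| "less_eq_rmax (Fin x) MInf = False"
| "less_eq_rmax (Fin x) (Fin y) = (x \<le> y)"

definition less_rmax :: "rmax \<Rightarrow> rmax \<Rightarrow> bool" where
  "less_rmax x y \<longleftrightarrow> x \<le> y \<and> \<not> y \<le> x"

instance
proof
  fix x y z :: rmax
  show "x < y \<longleftrightarrow> x \<le> y \<and> \<not> y \<le> x" by (simp add: less_rmax_def)
  show "x \<le> x" by (cases x) auto
  show "x \<le> y \<Longrightarrow> y \<le> z \<Longrightarrow> x \<le> z" by (cases x; cases y; cases z) auto
  show "x \<le> y \<Longrightarrow> y \<le> x \<Longrightarrow> x = y" by (cases x; cases y) auto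
  show "x \<le> y \<or> y \<le> x" by (cases x; cases y) auto
qed

end

instantiation rmax :: comm_semiring_1
begin

definition zero_rmax :: rmax where "zero_rmax = MInf"

definition one_rmax :: rmax where "one_rmax = Fin 0"

definition plus_rmax :: "rmax \<Rightarrow> rmax \<Rightarrow> rmax" where "plus_rmax x y = max x y"

fun times_rmax :: "rmax \<Rightarrow> rmax \<Rightarrow> rmax" where
  "times_rmax (Fin x) (Fin y) = Fin (x + y)"
| "times_rmax MInf y = MInf"
| "times_rmax x MInf = MInf"

instance
proof
  fix a b c :: rmax
  show "a * b * c = a * (b * c)" by (cases a; cases b; cases c) auto
  show "a * b = b * a" by (cases a; cases b) auto
  show "1 * a = a" by (cases a) (auto simp: one_rmax_def)
  show "a + b + c = a + (b + c)" by (simp add: plus_rmax_def max.assoc)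
  show "a + b = b + a" by (simp add: plus_rmax_def max.commute)
  show "0 + a = a" by (cases a) (auto simp: plus_rmax_def zero_rmax_def max_def)
  show "(a + b) * c = a * c + b * c"
    by (cases a; cases b; cases c) (auto simp: plus_rmax_def max_def)
  show "0 * a = 0" by (simp add: zero_rmax_def)
  show "a * 0 = 0" by (cases a) (simp_all add: zero_rmax_def)
  show "(0 :: rmax) \<noteq> 1" by (simp add: zero_rmax_def one_rmax_def)
qed

end

text \<open>
  Suprema and infima as in \<^typ>\<open>real\<close>: they are meaningful for nonempty bounded sets.  (The only
  use below is the Kleene star of a matrix without cycles of positive weight, where the powers
  are bounded.)
\<close>

instantiation rmax :: conditionally_complete_linorder
begin

definition inf_rmax :: "rmax \<Rightarrow> rmax \<Rightarrow> rmax" where "inf_rmax x y = min x y"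

definition sup_rmax :: "rmax \<Rightarrow> rmax \<Rightarrow> rmax" where "sup_rmax x y = max x y"

definition Sup_rmax :: "rmax set \<Rightarrow> rmax" where
  "Sup_rmax X = (if X \<subseteq> {MInf} then MInf else Fin (Sup {x. Fin x \<in> X}))"

definition Inf_rmax :: "rmax set \<Rightarrow> rmax" where
  "Inf_rmax X = (if MInf \<in> X \<or> (\<forall>b. \<exists>x\<in>X. x < Fin b) then MInf else Fin (Inf {x. Fin x \<in> X}))"

instance
proof
  fix x y z :: rmax and X :: "rmax set"
  show "inf x y \<le> x" "inf x y \<le> y" by (auto simp: inf_rmax_def)
  show "x \<le> y \<Longrightarrow> x \<le> z \<Longrightarrow> x \<le> inf y z" by (auto simp: inf_rmax_def)
  show "x \<le> sup x y" "y \<le> sup x y" by (auto simp: sup_rmax_def)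
  show "y \<le> x \<Longrightarrow> z \<le> x \<Longrightarrow> sup y z \<le> x" by (auto simp: sup_rmax_def)
  show "Inf X \<le> x" if x: "x \<in> X" and bdd: "bdd_below X"
  proof (cases "MInf \<in> X \<or> (\<forall>b. \<exists>x\<in>X. x < Fin b)")
    case False
    then obtain b where b: "\<And>w. w \<in> X \<Longrightarrow> Fin b \<le> w" by (meson not_less)
    obtain r where r: "x = Fin r" using False x by (cases x) auto
    have "bdd_below {x. Fin x \<in> X}" using b by (intro bdd_belowI[of _ b]) force
    then show ?thesis using False r x by (auto simp: Inf_rmax_def intro: cInf_lower)
  qed (auto simp: Inf_rmax_def)
  show "z \<le> Inf X" if ne: "X \<noteq> {}" and le: "\<And>x. x \<in> X \<Longrightarrow> z \<le> x"
  proof (cases z)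
    case (Fin r)
    have "MInf \<notin> X" using le Fin by force
    moreover have "\<not> (\<exists>x\<in>X. x < Fin r)" using le Fin by (force simp: not_less)
    moreover obtain w where "Fin w \<in> X" using ne \<open>MInf \<notin> X\<close> by (metis all_not_in_conv rmax.exhaust)
    moreover have "r \<le> Inf {x. Fin x \<in> X}"
      using \<open>Fin w \<in> X\<close> le Fin by (intro cInf_greatest) force+
    ultimately show ?thesis using Fin by (auto simp: Inf_rmax_def)
  qed simp
  show "x \<le> Sup X" if x: "x \<in> X" and bdd: "bdd_above X"
  proof (cases x)
    case (Fin r)
    obtain M where M: "\<And>w. w \<in> X \<Longrightarrow> w \<le> M" using bdd by (auto simp: bdd_above_def)
    obtain m where "M = Fin m" using M[OF x] Fin by (cases M) auto
    then have "bdd_above {x. Fin x \<in> X}" using M by (intro bdd_aboveI[of _ m]) force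
    then show ?thesis using Fin x by (auto simp: Sup_rmax_def intro: cSup_upper)
  qed simp
  show "Sup X \<le> z" if ne: "X \<noteq> {}" and le: "\<And>x. x \<in> X \<Longrightarrow> x \<le> z"
  proof (cases "X \<subseteq> {MInf}")
    case False
    then obtain r where r: "Fin r \<in> X" by (metis insertCI rmax.exhaust subsetI)
    obtain s where s: "z = Fin s" using le[OF r] by (cases z) auto
    have "Sup {x. Fin x \<in> X} \<le> s" using r le s by (intro cSup_least) force+
    then show ?thesis using False s by (simp add: Sup_rmax_def)
  qed (simp add: Sup_rmax_def)
qed

end


section \<open>Max-plus matrices\<close>

primrec mpow :: "rmax^'n^'n \<Rightarrow> nat \<Rightarrow> rmax^'n^'n" where
  "mpow A 0 = mat 1"
| "mpow A (Suc t) = A ** mpow A t"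

definition smult_mat :: "rmax \<Rightarrow> rmax^'n^'n \<Rightarrow> rmax^'n^'n" where
  "smult_mat c A = (\<chi> i j. c * A $ i $ j)"

definition kleene_star :: "rmax^'n^'n \<Rightarrow> rmax^'n^'n" where
  "kleene_star A = (\<chi> i j. SUP k. mpow A k $ i $ j)"

definition boolean_mat :: "rmax^'n^'n \<Rightarrow> bool" where
  "boolean_mat P \<longleftrightarrow> (\<forall>i j. P $ i $ j = 0 \<or> P $ i $ j = 1)"

text \<open>
  Periodic, not just ultimately periodic (every Boolean matrix is the latter).  The sequence of
  powers starts with \<open>P\<close> itself; including the zeroth power would force \<open>P\<close> to be invertible.
\<close>

definition periodic_mat :: "rmax^'n^'n \<Rightarrow> bool" where
  "periodic_mat P \<longleftrightarrow> (\<exists>p>0. \<forall>t\<ge>1. mpow P (t + p) = mpow P t)"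

definition diag_similar :: "rmax^'n^'n \<Rightarrow> rmax^'n^'n \<Rightarrow> bool" where
  "diag_similar S P \<longleftrightarrow>
     (\<exists>x :: 'n \<Rightarrow> real. \<forall>i j. P $ i $ j = Fin (- x i) * S $ i $ j * Fin (x j))"


section \<open>Digraph of a matrix, critical graph\<close>

definition mat_digraph :: "rmax^'n^'n \<Rightarrow> ('n, 'n \<times> 'n) pre_digraph" where
  "mat_digraph A = \<lparr>verts = UNIV, arcs = {(i, j). A $ i $ j \<noteq> 0}, tail = fst, head = snd\<rparr>"

abbreviation mat_cycle :: "rmax^'n^'n \<Rightarrow> ('n \<times> 'n) list \<Rightarrow> bool" where
  "mat_cycle A \<equiv> pre_digraph.cycle (mat_digraph A)"

definition mean_weight :: "rmax^'n^'n \<Rightarrow> ('n \<times> 'n) list \<Rightarrow> real" where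
  "mean_weight A p = (\<Sum>(i, j)\<leftarrow>p. the_real (A $ i $ j)) / real (length p)"

text \<open>Meaningful only if the digraph of \<open>A\<close> has a cycle (otherwise \<open>\<lambda>(A)\<close> is \<open>-\<infinity>\<close>).\<close>

definition max_cycle_mean :: "rmax^'n^'n \<Rightarrow> real" where
  "max_cycle_mean A = Max {mean_weight A p | p. mat_cycle A p}"

text \<open>The greatest length of a cycle, with value 0 for an acyclic digraph.\<close>

definition cr :: "('a, 'b) pre_digraph \<Rightarrow> nat" where
  "cr G = Max (insert 0 {length p | p. pre_digraph.cycle G p})"

definition critical_cycle :: "rmax^'n^'n \<Rightarrow> ('n \<times> 'n) list \<Rightarrow> bool" where
  "critical_cycle A p \<longleftrightarrow> mat_cycle A p \<and> mean_weight A p = max_cycle_mean A"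

definition critical_graph :: "rmax^'n^'n \<Rightarrow> ('n, 'n \<times> 'n) pre_digraph" where
  "critical_graph A =
     \<lparr>verts = {v. \<exists>p e. critical_cycle A p \<and> e \<in> set p \<and> (v = fst e \<or> v = snd e)},
      arcs = {e. \<exists>p. critical_cycle A p \<and> e \<in> set p},
      tail = fst, head = snd\<rparr>"

text \<open>The empty walk contributes length 0, which does not affect the gcd.\<close>

definition scc_cyclicity :: "('a, 'b) pre_digraph \<Rightarrow> nat" where
  "scc_cyclicity G = Gcd {length p | p u. pre_digraph.awalk G u p u}"

definition cyclicity :: "('a, 'b) pre_digraph \<Rightarrow> nat" where
  "cyclicity G = Lcm (scc_cyclicity ` pre_digraph.sccs G)"

definition representing_subgraph ::
  "('a, 'b) pre_digraph \<Rightarrow> ('a, 'b) pre_digraph \<Rightarrow> bool" where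
  "representing_subgraph G H \<longleftrightarrow>
     subgraph G H \<and>
     (\<forall>L\<in>pre_digraph.sccs G. \<forall>L'\<in>pre_digraph.sccs G. L \<noteq> L' \<longrightarrow>
        \<not> (\<exists>e\<in>arcs G. tail G e \<in> verts L \<and> head G e \<in> verts L')) \<and>
     (\<forall>K\<in>pre_digraph.sccs H. \<exists>!L. L \<in> pre_digraph.sccs G \<and> subgraph L K)"

definition no_trivial_scc :: "('a, 'b) pre_digraph \<Rightarrow> bool" where
  "no_trivial_scc G \<longleftrightarrow> (\<forall>L\<in>pre_digraph.sccs G. arcs L \<noteq> {})"


section \<open>CSR terms and weak CSR expansions\<close>

definition normalized_mat :: "rmax^'n^'n \<Rightarrow> rmax^'n^'n" where
  "normalized_mat A = smult_mat (Fin (- max_cycle_mean A)) A"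

definition csr_M :: "rmax^'n^'n \<Rightarrow> ('n, 'n \<times> 'n) pre_digraph \<Rightarrow> rmax^'n^'n" where
  "csr_M A G = kleene_star (mpow (normalized_mat A) (cyclicity G))"

definition csr_C :: "rmax^'n^'n \<Rightarrow> ('n, 'n \<times> 'n) pre_digraph \<Rightarrow> rmax^'n^'n" where
  "csr_C A G = (\<chi> i j. if j \<in> verts G then csr_M A G $ i $ j else 0)"

definition csr_R :: "rmax^'n^'n \<Rightarrow> ('n, 'n \<times> 'n) pre_digraph \<Rightarrow> rmax^'n^'n" where
  "csr_R A G = (\<chi> i j. if i \<in> verts G then csr_M A G $ i $ j else 0)"

definition csr_S :: "rmax^'n^'n \<Rightarrow> ('n, 'n \<times> 'n) pre_digraph \<Rightarrow> rmax^'n^'n" where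
  "csr_S A G = (\<chi> i j. if (i, j) \<in> arcs G then normalized_mat A $ i $ j else 0)"

text \<open>
  \<open>B\<close> arises from \<open>A\<close> by setting entries to \<open>-\<infinity>\<close> so that its digraph is disjoint from the
  critical graph of \<open>A\<close>.  As \<^const>\<open>mat_digraph\<close> always has all indices as nodes, disjointness
  means that no edge of the digraph of \<open>B\<close> has a critical end node.
\<close>

definition csr_remainder :: "rmax^'n^'n \<Rightarrow> rmax^'n^'n \<Rightarrow> bool" where
  "csr_remainder A B \<longleftrightarrow>
     (\<forall>i j. B $ i $ j = A $ i $ j \<or> B $ i $ j = 0) \<and>
     (\<forall>(i, j) \<in> arcs (mat_digraph B).
        i \<notin> verts (critical_graph A) \<and> j \<notin> verts (critical_graph A))"

definition csr_term ::
  "real \<Rightarrow> rmax^'n^'n \<Rightarrow> rmax^'n^'n \<Rightarrow> rmax^'n^'n \<Rightarrow> nat \<Rightarrow> rmax^'n^'n" where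
  "csr_term l C S R t = smult_mat (Fin l ^ t) (C ** mpow S t ** R)"

definition weak_csr_expansion ::
  "rmax^'n^'n \<Rightarrow> real \<Rightarrow> rmax^'n^'n \<Rightarrow> rmax^'n^'n \<Rightarrow> rmax^'n^'n \<Rightarrow> rmax^'n^'n \<Rightarrow> bool" where
  "weak_csr_expansion A l C S R B \<longleftrightarrow>
     (\<exists>p. mat_cycle A p) \<and> l = max_cycle_mean A \<and>
     (\<exists>G. representing_subgraph G (critical_graph A) \<and> no_trivial_scc G \<and>
          C = csr_C A G \<and> S = csr_S A G \<and> R = csr_R A G) \<and>
     csr_remainder A B \<and>
     (\<forall>\<^sub>F t in sequentially. mpow A t = csr_term l C S R t + mpow B t)"

text \<open>
  \<open>B i\<close> is what remains after \<open>i\<close> steps; the process stops when the remainder has no cycle, so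
  that no further expansion is possible (its powers are eventually \<open>-\<infinity>\<close>).
\<close>

definition iterated_weak_csr ::
  "rmax^'n^'n \<Rightarrow> nat \<Rightarrow> (nat \<Rightarrow> real) \<Rightarrow> (nat \<Rightarrow> rmax^'n^'n) \<Rightarrow> (nat \<Rightarrow> rmax^'n^'n) \<Rightarrow>
     (nat \<Rightarrow> rmax^'n^'n) \<Rightarrow> bool" where
  "iterated_weak_csr A K l C S R \<longleftrightarrow>
     (\<exists>B :: nat \<Rightarrow> rmax^'n^'n. B 0 = A \<and>
        (\<forall>i\<in>{1..K}. weak_csr_expansion (B (i - 1)) (l i) (C i) (S i) (R i) (B i)) \<and>
        \<not> (\<exists>p. mat_cycle (B K) p))"

definition Wi :: "nat \<Rightarrow> nat" where
  "Wi n = (if n > 1 then (n - 1)\<^sup>2 + 1 else 0)"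

end

theory Submission
  imports Defs
begin

text \<open>
  At every step \<open>B\<close> is obtained from \<open>A\<close> by deleting the rows and columns of all critical nodes, and
  the representing subgraph consists of one critical cycle for each strongly connected component
  of the critical graph.  Its \<open>S\<close> is then, up to a diagonal similarity given by a potential, a
  partial permutation matrix, so its powers are periodic from the start.

  After subtracting \<open>\<lambda>(A)\<close> all closed walks have weight at most \<open>0\<close>.  A walk of length \<open>t\<close> either avoids
  the critical nodes and is counted in \<open>B\<^sup>t\<close>, or it meets one and is dominated by the CSR term for
  every \<open>t\<close>.  Conversely, an entry of the CSR term is the weight of a walk through a chosen cycle \<open>Z\<close> of
  length \<open>\<ell>\<close>, and this walk has length congruent to \<open>t\<close> modulo \<open>\<ell>\<close>.  Removing closed subwalks of total
  length divisible by \<open>\<ell>\<close> (pigeonhole on residues) does not lower the weight and leaves length at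
  most \<open>(n - 1)\<ell> + n - 1\<close>, and copies of \<open>Z\<close> restore the length \<open>t\<close>; this needs
  \<open>t \<ge> (n - 2)\<ell> + n\<close>, which is implied by both bounds when \<open>\<ell> < n\<close>.  For a Hamiltonian \<open>Z\<close> a sharper count
  removes whole simple cycles: fewer than \<open>n\<close> of them can remain, each of length below \<open>n\<close>.

  Each step lowers the number of nodes with an incident edge, so there are at most \<open>n\<close> steps, and
  the powers of the final acyclic matrix vanish from \<open>n\<close> on, which lies below the bound if \<open>n \<ge> 2\<close>.
\<close>

section \<open>Order and arithmetic of the max-plus semiring\<close>

instance rmax :: canonically_ordered_monoid_add
proof
  fix a b :: rmax
  show "a \<le> b \<longleftrightarrow> (\<exists>c. b = a + c)"
    by (metis max.absorb2 max.cobounded1 plus_rmax_def)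
qed

instance rmax :: ordered_comm_semiring
proof
  fix a b c :: rmax
  show "a \<le> b \<Longrightarrow> 0 \<le> c \<Longrightarrow> c * a \<le> c * b"
    by (cases a; cases b; cases c) auto
qed

lemma rmax_mult_mono: "a \<le> b \<Longrightarrow> c \<le> d \<Longrightarrow> a * c \<le> b * d" for a b c d :: rmax
  by (rule mult_mono) auto

lemma rmax_mult_eq_0_iff [simp]: "a * b = 0 \<longleftrightarrow> a = 0 \<or> b = 0" for a b :: rmax
  by (cases a; cases b) (auto simp: zero_rmax_def)

lemma rmax_mult_le_left: "x \<le> 1 \<Longrightarrow> a * x \<le> a" for a x :: rmax
  using rmax_mult_mono[of a a x 1] by simp

lemma rmax_mult_ge_left: "1 \<le> x \<Longrightarrow> a \<le> a * x" for a x :: rmax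
  using rmax_mult_mono[of a a 1 x] by simp

lemma Fin_neq_0 [simp]: "Fin r \<noteq> 0" "0 \<noteq> Fin r"
  by (simp_all add: zero_rmax_def)

lemma rmax_neq_0E: assumes "x \<noteq> (0 :: rmax)" obtains r where "x = Fin r"
  using assms by (cases x) (auto simp: zero_rmax_def)

lemma Fin_power: "Fin l ^ t = Fin (real t * l)"
  by (induction t) (simp_all add: one_rmax_def algebra_simps)

lemma rmax_sum_le: "(\<And>a. a \<in> S \<Longrightarrow> f a \<le> b) \<Longrightarrow> sum f S \<le> b" for b :: rmax
  by (induction S rule: infinite_finite_induct) (auto simp: plus_rmax_def)

lemma rmax_sum_ge: "finite S \<Longrightarrow> a \<in> S \<Longrightarrow> f a \<le> sum f S" for f :: "'a \<Rightarrow> rmax"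
  by (rule member_le_sum) auto

lemma rmax_sum_attained: "finite S \<Longrightarrow> S \<noteq> {} \<Longrightarrow> \<exists>a\<in>S. sum f S = f a" for f :: "'a \<Rightarrow> rmax"
proof (induction S rule: finite_ne_induct)
  case (insert x F)
  then show ?case
    by (auto simp: plus_rmax_def max_def)
qed auto

section \<open>Entries of max-plus matrix products and powers\<close>

lemma matrix_mul_le_iff:
  fixes A B C :: "rmax^'n^'n"
  shows "(A ** B) $ i $ j \<le> x \<longleftrightarrow> (\<forall>k. A $ i $ k * B $ k $ j \<le> x)"
proof
  have "A $ i $ k * B $ k $ j \<le> (A ** B) $ i $ j" for k
    using rmax_sum_ge[of UNIV k "\<lambda>k. A $ i $ k * B $ k $ j"] by (simp add: matrix_matrix_mult_def)
  then show "(A ** B) $ i $ j \<le> x \<Longrightarrow> \<forall>k. A $ i $ k * B $ k $ j \<le> x"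
    using order_trans by blast
qed (simp add: matrix_matrix_mult_def rmax_sum_le)

lemma matrix_mul_ge: "A $ i $ k * B $ k $ j \<le> (A ** B) $ i $ j" for A B :: "rmax^'n^'n"
  using matrix_mul_le_iff by blast

lemma matrix_mul_attained: "\<exists>k. (A ** B) $ i $ j = A $ i $ k * B $ k $ j" for A B :: "rmax^'n^'n"
  using rmax_sum_attained[of UNIV "\<lambda>k. A $ i $ k * B $ k $ j"] by (auto simp: matrix_matrix_mult_def)

lemma mpow_add: "mpow A (s + t) = mpow A s ** mpow A t"
  by (induction s) (simp_all add: matrix_mul_assoc)

lemma mpow_mult: "mpow (mpow A s) t = mpow A (s * t)"
  by (induction t) (simp_all add: mpow_add)

lemma mpow_1 [simp]: "mpow A (Suc 0) = A"
  by simp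

lemma mpow_ge: "mpow A s $ i $ v * mpow A t $ v $ j \<le> mpow A (s + t) $ i $ j"
  unfolding mpow_add by (rule matrix_mul_ge)

section \<open>Walks and their weights\<close>

text \<open>A walk is a function on all of \<open>nat\<close> of which only the values on
  \<open>{a..b}\<close> matter. A walk and its subwalks then share one \<open>w\<close>, and
  splitting a walk is splitting an interval.\<close>

definition wwt :: "rmax^'n^'n \<Rightarrow> (nat \<Rightarrow> 'n) \<Rightarrow> nat \<Rightarrow> nat \<Rightarrow> rmax" where
  "wwt A w a b = (\<Prod>k\<in>{a..<b}. A $ w k $ w (Suc k))"

lemma wwt_split: "a \<le> b \<Longrightarrow> b \<le> c \<Longrightarrow> wwt A w a c = wwt A w a b * wwt A w b c"
  by (simp add: wwt_def prod.atLeastLessThan_concat)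

lemma wwt_same [simp]: "wwt A w a a = 1"
  by (simp add: wwt_def)

lemma wwt_Suc: "a \<le> b \<Longrightarrow> wwt A w a (Suc b) = wwt A w a b * A $ w b $ w (Suc b)"
  by (simp add: wwt_def)

lemma wwt_shift: "wwt A (\<lambda>k. w (k + c)) a b = wwt A w (a + c) (b + c)"
  unfolding wwt_def using prod.shift_bounds_nat_ivl[of "\<lambda>k. A $ w k $ w (Suc k)" a c b] by simp

lemma wwt_cong:
  "(\<And>k. a \<le> k \<Longrightarrow> k \<le> b \<Longrightarrow> w k = w' k) \<Longrightarrow> wwt A w a b = wwt A w' a b"
  unfolding wwt_def by (rule prod.cong) auto

lemma wwt_le_mpow:
  assumes "a \<le> b" shows "wwt A w a b \<le> mpow A (b - a) $ w a $ w b"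
  using assms
proof (induction b rule: dec_induct)
  case base
  then show ?case by (simp add: mat_def)
next
  case (step b)
  have "wwt A w a (Suc b) \<le> mpow A (b - a) $ w a $ w b * mpow A 1 $ w b $ w (Suc b)"
    using step by (auto simp: wwt_Suc intro!: rmax_mult_mono)
  also have "\<dots> \<le> mpow A (Suc b - a) $ w a $ w (Suc b)"
    using mpow_ge[of A "b - a" "w a" "w b" 1 "w (Suc b)"] step by (simp add: Suc_diff_le)
  finally show ?case .
qed

text \<open>Choosing a maximising index in each product builds an optimal walk. The entry has to be
  finite: for \<open>t = 0\<close> and \<open>i \<noteq> j\<close> there is no walk at all.\<close>

lemma ex_walk:
  assumes "mpow A t $ i $ j \<noteq> 0"
  shows "\<exists>w. w 0 = i \<and> w t = j \<and> mpow A t $ i $ j = wwt A w 0 t"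
  using assms
proof (induction t arbitrary: i)
  case 0
  then show ?case by (auto simp: mat_def intro!: exI[of _ "\<lambda>_. i"] split: if_splits)
next
  case (Suc t)
  obtain k where k: "mpow A (Suc t) $ i $ j = A $ i $ k * mpow A t $ k $ j"
    using matrix_mul_attained[of A "mpow A t" i j] by auto
  with Suc obtain w where w: "w 0 = k" "w t = j" "mpow A t $ k $ j = wwt A w 0 t"
    by fastforce
  define v where "v = case_nat i w"
  have "wwt A v 0 (Suc t) = A $ i $ k * wwt A w 0 t"
    unfolding wwt_def prod.atLeast0_lessThan_Suc_shift using w by (simp add: v_def)
  then show ?case using k w by (intro exI[of _ v]) (auto simp: v_def)
qed

lemma ex_walk_via:
  assumes "mpow A s $ i $ u * mpow A t $ u $ j \<noteq> 0"
  shows "\<exists>w. w 0 = i \<and> w s = u \<and> w (s + t) = j \<and>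
    mpow A s $ i $ u = wwt A w 0 s \<and> mpow A t $ u $ j = wwt A w s (s + t)"
proof -
  obtain w where w: "w 0 = i" "w s = u" "mpow A s $ i $ u = wwt A w 0 s"
    using ex_walk[of A s i u] assms by auto
  obtain v where v: "v 0 = u" "v t = j" "mpow A t $ u $ j = wwt A v 0 t"
    using ex_walk[of A t u j] assms by auto
  define z where "z k = (if k \<le> s then w k else v (k - s))" for k
  have "wwt A z 0 s = wwt A w 0 s"
    by (rule wwt_cong) (auto simp: z_def)
  moreover have "wwt A v 0 t = wwt A (\<lambda>k. z (k + s)) 0 t"
    by (rule wwt_cong) (use w v in \<open>auto simp: z_def\<close>)
  then have "wwt A v 0 t = wwt A z s (s + t)"
    by (simp add: wwt_shift add.commute)
  ultimately show ?thesis using w v by (intro exI[of _ z]) (auto simp: z_def)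
qed

text \<open>
  The last argument records the visited nodes: a closed walk can be inserted at any of them.
\<close>

inductive vwalk :: "rmax^'n^'n \<Rightarrow> 'n \<Rightarrow> 'n \<Rightarrow> nat \<Rightarrow> rmax \<Rightarrow> 'n set \<Rightarrow> bool" for A i where
  refl: "vwalk A i i 0 1 {i}"
| step: "vwalk A i j L x X \<Longrightarrow> vwalk A i k (Suc L) (x * A $ j $ k) (insert k X)"

lemma vwalk_le_mpow: "vwalk A i j L x X \<Longrightarrow> x \<le> mpow A L $ i $ j"
proof (induction rule: vwalk.induct)
  case (step j L x X k)
  have "x * A $ j $ k \<le> mpow A L $ i $ j * mpow A 1 $ j $ k"
    using step by (auto intro: rmax_mult_mono)
  also have "\<dots> \<le> mpow A (Suc L) $ i $ k"
    using mpow_ge[of A L i j 1 k] by simp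
  finally show ?case .
qed (simp add: mat_def)

lemma vwalk_ends: "vwalk A i j L x X \<Longrightarrow> i \<in> X \<and> j \<in> X"
  by (induction rule: vwalk.induct) auto

lemma vwalk_append:
  assumes "vwalk A j k M y Y" "vwalk A i j L x X"
  shows "vwalk A i k (L + M) (x * y) (X \<union> Y)"
  using assms
proof (induction rule: vwalk.induct)
  case refl
  then show ?case using vwalk_ends[OF refl] by (simp add: insert_absorb)
next
  case (step k M y Y m)
  then show ?case using vwalk.step[of A i k "L + M" "x * y" "X \<union> Y" m]
    by (simp add: mult.assoc)
qed

text \<open>The closed walk is spliced in at the first visit to \<open>v\<close>: either
  \<open>v\<close> occurs in the prefix, or it is the node just reached and the closed walk is
  appended there.\<close>

lemma vwalk_insert:
  assumes "vwalk A i j L x X" "v \<in> X" "vwalk A v v M y Y"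
  shows "vwalk A i j (L + M) (x * y) (X \<union> Y)"
  using assms
proof (induction rule: vwalk.induct)
  case refl
  then show ?case using vwalk_ends[OF refl(2)] by (simp add: insert_absorb)
next
  case (step j L x X k)
  show ?case
  proof (cases "v \<in> X")
    case True
    with step have "vwalk A i j (L + M) (x * y) (X \<union> Y)" by simp
    from vwalk.step[OF this, of k] show ?thesis by (simp add: mult_ac)
  next
    case False
    with step have "v = k" by simp
    with step.prems have "vwalk A k k M y Y" by simp
    from vwalk_append[OF this vwalk.step[OF step.hyps, of k]] show ?thesis by (simp add: insert_absorb)
  qed
qed

lemma vwalk_fun:
  assumes "a \<le> b" shows "vwalk A (w a) (w b) (b - a) (wwt A w a b) (w ` {a..b})"
  using assms
proof (induction b rule: dec_induct)
  case base
  show ?case using vwalk.refl[of A "w a"] by simp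
next
  case (step b)
  have "w ` {a..Suc b} = insert (w (Suc b)) (w ` {a..b})"
    using step by (simp add: atLeastAtMostSuc_conv)
  with vwalk.step[OF step(3), of "w (Suc b)"] step show ?case
    by (simp add: Suc_diff_le wwt_Suc)
qed

text \<open>Residues are taken of \<open>f k\<close> instead of \<open>k\<close> so that the same
  count serves for plain positions, for positions measured with a segment left out, and for partial
  sums of lengths.\<close>

lemma pigeonhole_mod:
  fixes f :: "nat \<Rightarrow> nat"
  assumes "m > 0" "finite S" "card S > m"
  obtains x y where "x \<in> S" "y \<in> S" "x < y" "f x mod m = f y mod m"
proof -
  have "card ((\<lambda>k. f k mod m) ` S) \<le> card {..<m}"
    using assms by (intro card_mono) auto
  then have "\<not> inj_on (\<lambda>k. f k mod m) S"
    using assms pigeonhole[of "\<lambda>k. f k mod m" S] by simp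
  then show thesis
    unfolding inj_on_def by (metis linorder_neqE_nat that)
qed

section \<open>Cycle removal\<close>

text \<open>A simple cycle is remembered only by its node set and weight. By injectivity its length
  is \<open>card V\<close>, and it can be started at any of its nodes.\<close>

definition simple_closed :: "rmax^'n^'n \<Rightarrow> 'n set \<Rightarrow> rmax \<Rightarrow> bool" where
  "simple_closed A V y \<longleftrightarrow>
     (\<exists>w d. 0 < d \<and> inj_on w {0..<d} \<and> w d = w 0 \<and> V = w ` {0..<d} \<and> y = wwt A w 0 d)"

lemma simple_closed_vwalk:
  assumes "simple_closed A V y" "v \<in> V"
  shows "vwalk A v v (card V) y V"
proof -
  obtain w d where w: "0 < d" "inj_on w {0..<d}" "w d = w 0" "V = w ` {0..<d}" "y = wwt A w 0 d"
    using assms(1) by (auto simp: simple_closed_def)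
  obtain m where m: "m < d" "v = w m" using assms(2) w by auto
  have "vwalk A v (w 0) (d - m) (wwt A w m d) (w ` {m..d})"
    using vwalk_fun[of m d A w] m w by simp
  moreover have "vwalk A (w 0) v m (wwt A w 0 m) (w ` {0..m})"
    using vwalk_fun[of 0 m A w] m w by simp
  ultimately have "vwalk A v v (d - m + m) (wwt A w m d * wwt A w 0 m) (w ` {m..d} \<union> w ` {0..m})"
    by (metis vwalk_append)
  moreover have "w ` {m..d} \<union> w ` {0..m} = V"
  proof -
    have "{m..d} \<union> {0..m} = insert d {0..<d}" using m by auto
    then have "w ` {m..d} \<union> w ` {0..m} = insert (w d) (w ` {0..<d})" by (metis image_Un image_insert)
    then show ?thesis using w by (simp add: insert_absorb)
  qed
  moreover have "card V = d" using w by (simp add: card_image)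
  moreover have "wwt A w m d * wwt A w 0 m = y"
    using w m by (simp add: wwt_split[of 0 m d] mult.commute)
  ultimately show ?thesis using m by simp
qed

lemma simple_closed_pos: "simple_closed A V y \<Longrightarrow> 0 < card V"
  by (auto simp: simple_closed_def card_gt_0_iff)

abbreviation msum :: "('n set \<times> rmax) multiset \<Rightarrow> nat" where
  "msum M \<equiv> (\<Sum>c\<in>#M. card (fst c))"

abbreviation mprod :: "('n set \<times> rmax) multiset \<Rightarrow> rmax" where
  "mprod M \<equiv> (\<Prod>c\<in>#M. snd c)"

abbreviation simple_cycles :: "rmax^'n^'n \<Rightarrow> ('n set \<times> rmax) multiset \<Rightarrow> bool" where
  "simple_cycles A M \<equiv> (\<forall>c\<in>#M. simple_closed A (fst c) (snd c))"

text \<open>Take the earliest index \<open>b\<close> whose node occurred before. By minimality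
  nothing repeats strictly before \<open>b\<close>, so the segment closed at \<open>b\<close> is
  simple.\<close>

lemma closed_subwalk:
  assumes "\<not> inj_on w {0..L::nat}"
  obtains a b where "a < b" "b \<le> L" "w a = w b" "inj_on w {a..<b}"
proof -
  define P where "P b \<longleftrightarrow> b \<le> L \<and> (\<exists>a<b. w a = w b)" for b
  have "\<exists>b. P b"
    using assms unfolding inj_on_def P_def by (metis atLeastAtMost_iff linorder_neqE_nat)
  then have *: "P (LEAST b. P b)" by (metis LeastI)
  define b where "b = (LEAST b. P b)"
  obtain a where "a < b" "b \<le> L" "w a = w b" using * by (auto simp: P_def b_def)
  moreover have "inj_on w {a..<b}"
  proof (rule ccontr)
    assume "\<not> inj_on w {a..<b}"
    then obtain c d where "c < d" "d < b" "w c = w d"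
      unfolding inj_on_def by (metis atLeastLessThan_iff linorder_neqE_nat)
    then have "P d" using \<open>b \<le> L\<close> by (auto simp: P_def)
    then show False using \<open>d < b\<close> not_less_Least b_def by blast
  qed
  ultimately show thesis using that by blast
qed

lemma wwt_cut_le_mpow:
  assumes "a \<le> b" "b \<le> L" "w a = w b"
  shows "wwt A w 0 a * wwt A w b L \<le> mpow A (L - (b - a)) $ w 0 $ w L"
proof -
  have "wwt A w 0 a * wwt A w b L \<le> mpow A a $ w 0 $ w a * mpow A (L - b) $ w a $ w L"
    using wwt_le_mpow[of 0 a A w] wwt_le_mpow[of b L A w] assms by (auto intro: rmax_mult_mono)
  also have "\<dots> \<le> mpow A (a + (L - b)) $ w 0 $ w L" by (rule mpow_ge)
  also have "a + (L - b) = L - (b - a)" using assms by simp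
  finally show ?thesis .
qed

lemma simple_closed_subwalk:
  assumes "a < b" "w a = w b" "inj_on w {a..<b}"
  shows "simple_closed A (w ` {a..<b}) (wwt A w a b)"
  unfolding simple_closed_def
proof (intro exI conjI)
  show "0 < b - a" "(\<lambda>k. w (k + a)) (b - a) = (\<lambda>k. w (k + a)) 0" using assms by auto
  show "inj_on (\<lambda>k. w (k + a)) {0..<b - a}"
  proof (rule inj_onI)
    fix x y assume "x \<in> {0..<b - a}" "y \<in> {0..<b - a}" "w (x + a) = w (y + a)"
    then show "x = y" using inj_onD[OF assms(3), of "x + a" "y + a"] by auto
  qed
  have "(\<lambda>k. k + a) ` {0..<b - a} = {a..<b}"
    using assms(1) by (simp add: image_add_atLeastLessThan' )
  then show "w ` {a..<b} = (\<lambda>k. w (k + a)) ` {0..<b - a}"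
    by (metis image_image)
  show "wwt A w a b = wwt A (\<lambda>k. w (k + a)) 0 (b - a)"
    using assms(1) by (simp add: wwt_shift)
qed

text \<open>Simple closed subwalks are peeled off until a path is left; a path from \<open>i\<close>
  to \<open>i\<close> is empty, hence the disjunction on \<open>p\<close>. Connectedness is lost
  here: a cycle in \<open>M\<close> may have touched the walk only through a part that was removed
  later.\<close>

lemma cycle_decomposition:
  fixes A :: "rmax^'n^'n"
  assumes "mpow A L $ i $ j \<noteq> 0"
  shows "\<exists>p x X M. vwalk A i j p x X \<and> (p = 0 \<or> i \<noteq> j) \<and> p < CARD('n) \<and> simple_cycles A M \<and>
    p + msum M = L \<and> mpow A L $ i $ j \<le> x * mprod M"
  using assms
proof (induction L rule: less_induct)
  case (less L)
  obtain w where w: "w 0 = i" "w L = j" "mpow A L $ i $ j = wwt A w 0 L"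
    using ex_walk[OF less.prems] by blast
  show ?case
  proof (cases "inj_on w {0..L}")
    case True
    have "L = 0 \<or> i \<noteq> j" using w inj_onD[OF True, of 0 L] by auto
    moreover have "card {0..L} \<le> CARD('n)"
      using card_inj_on_le[OF True, of UNIV] by simp
    then have "L < CARD('n)" by simp
    moreover have "vwalk A i j L (wwt A w 0 L) (w ` {0..L})"
      using vwalk_fun[of 0 L A w] w by simp
    ultimately show ?thesis
      using w by (intro exI[of _ L] exI[of _ "wwt A w 0 L"] exI[of _ "w ` {0..L}"] exI[of _ "{#}"]) auto
  next
    case False
    then obtain a b where ab: "a < b" "b \<le> L" "w a = w b" "inj_on w {a..<b}"
      by (rule closed_subwalk)
    let ?L = "L - (b - a)"
    have eq: "wwt A w 0 L = wwt A w 0 a * wwt A w b L * wwt A w a b"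
      using wwt_split[of 0 a L A w] wwt_split[of a b L A w] ab by (simp add: mult_ac)
    have cut: "wwt A w 0 a * wwt A w b L \<le> mpow A ?L $ i $ j"
      using wwt_cut_le_mpow[of a b L w A] ab w by simp
    have "mpow A ?L $ i $ j \<noteq> 0" using cut eq less.prems w by auto
    moreover have "?L < L" using ab by linarith
    ultimately obtain p x X M where IH: "vwalk A i j p x X" "p = 0 \<or> i \<noteq> j" "p < CARD('n)"
      "simple_cycles A M" "p + msum M = ?L" "mpow A ?L $ i $ j \<le> x * mprod M"
      using less.IH[of ?L] by blast
    define N where "N = add_mset (w ` {a..<b}, wwt A w a b) M"
    have "simple_cycles A N"
      using simple_closed_subwalk[OF ab(1,3,4)] IH(4) by (auto simp: N_def)
    moreover have "p + msum N = L"
      using IH(5) ab by (simp add: N_def card_image)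
    moreover have "mpow A L $ i $ j \<le> x * mprod N"
      using rmax_mult_mono[OF order_trans[OF cut IH(6)] order_refl[of "wwt A w a b"]] eq w
      by (simp add: N_def mult_ac)
    ultimately show ?thesis using IH(1-3) by blast
  qed
qed

text \<open>Insertion only enlarges the set of visited nodes, so a cycle meeting the original
  \<open>X\<close> can still be inserted after all the others.\<close>

lemma vwalk_insert_cycles:
  assumes "simple_cycles A M" "\<forall>c\<in>#M. fst c \<inter> X \<noteq> {}" "vwalk A i j L x X"
  shows "\<exists>Y. X \<subseteq> Y \<and> vwalk A i j (L + msum M) (x * mprod M) Y"
  using assms
proof (induction M)
  case (add c M)
  then obtain Y where Y: "X \<subseteq> Y" "vwalk A i j (L + msum M) (x * mprod M) Y" by auto
  obtain v where v: "v \<in> fst c" "v \<in> X" using add.prems by auto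
  have "vwalk A v v (card (fst c)) (snd c) (fst c)"
    using simple_closed_vwalk[of A "fst c" "snd c" v] v add.prems by auto
  from vwalk_insert[OF Y(2) _ this] v Y have
    "vwalk A i j (L + msum M + card (fst c)) (x * mprod M * snd c) (Y \<union> fst c)" by blast
  then show ?case using Y by (intro exI[of _ "Y \<union> fst c"]) (auto simp: mult_ac add_ac)
qed auto

text \<open>For equal end nodes the path left by the decomposition is empty, so a closed walk is
  bounded by a product of weights of simple cycles.\<close>

lemma definite_if_simple_cycles:
  assumes "\<And>V y. simple_closed A V y \<Longrightarrow> y \<le> 1"
  shows "mpow A k $ v $ v \<le> 1"
proof (cases "mpow A k $ v $ v = 0")
  case False
  from cycle_decomposition[OF this] obtain p x X M where
    *: "vwalk A v v p x X" "p = 0" "simple_cycles A M" "mpow A k $ v $ v \<le> x * mprod M" by blast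
  have "mprod M \<le> 1"
    using *(3) assms by (induction M) (auto intro: order_trans[OF rmax_mult_mono[of _ 1 _ 1]])
  moreover have "x \<le> 1" using vwalk_le_mpow[OF *(1)] *(2) by (simp add: mat_def)
  ultimately show ?thesis using * rmax_mult_mono[of x 1 "mprod M" 1] by simp
qed auto

section \<open>Matrices whose closed walks have weight at most \<open>1\<close>, the real number
  zero\<close>

locale definite =
  fixes A :: "rmax^'n^'n"
  assumes closed_le_1: "mpow A k $ v $ v \<le> 1"
begin

lemma wwt_closed_le_1: "a \<le> b \<Longrightarrow> w a = w b \<Longrightarrow> wwt A w a b \<le> 1"
  using wwt_le_mpow[of a b A w] closed_le_1[of "b - a" "w a"] by simp

lemma wwt_remove:
  assumes "a \<le> b" "b \<le> L" "w a = w b"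
  shows "wwt A w 0 L \<le> wwt A w 0 a * wwt A w b L"
proof -
  have "wwt A w 0 L = wwt A w 0 a * wwt A w b L * wwt A w a b"
    using wwt_split[of 0 a L A w] wwt_split[of a b L A w] assms by (simp add: mult_ac)
  then show ?thesis using rmax_mult_le_left wwt_closed_le_1[of a b w] assms by simp
qed

text \<open>Pigeonhole on the pairs of node and position modulo \<open>g\<close>: a repeated pair
  encloses a closed subwalk of length divisible by \<open>g\<close>, whose removal does not lower
  the weight. With \<open>g = 1\<close> this bounds the walks defining a potential; with
  \<open>g\<close> the cyclicity it makes the Kleene star a maximum.\<close>

lemma mpow_reduce:
  assumes "g > 0"
  shows "\<exists>L' < CARD('n) * g. L' mod g = L mod g \<and> mpow A L $ i $ j \<le> mpow A L' $ i $ j"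
proof (induction L rule: less_induct)
  case (less L)
  consider "L < CARD('n) * g" | "mpow A L $ i $ j = 0"
    | "L \<ge> CARD('n) * g" "mpow A L $ i $ j \<noteq> 0" by linarith
  then show ?case
  proof cases
    case 2
    have "L mod g < g" using assms by simp
    also have "g \<le> CARD('n) * g" by simp
    finally show ?thesis using 2 by (intro exI[of _ "L mod g"]) auto
  next
    case 3
    obtain w where w: "w 0 = i" "w L = j" "mpow A L $ i $ j = wwt A w 0 L"
      using ex_walk[OF 3(2)] by blast
    have "card ((\<lambda>k. (w k, k mod g)) ` {0..L}) \<le> card ((UNIV :: 'n set) \<times> {..<g})"
      using assms by (intro card_mono) auto
    then have "\<not> inj_on (\<lambda>k. (w k, k mod g)) {0..L}"
      using 3(1) pigeonhole[of "\<lambda>k. (w k, k mod g)" "{0..L}"] by (simp add: card_cartesian_product)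
    then obtain a b where ab: "a < b" "b \<le> L" "w a = w b" "a mod g = b mod g"
      unfolding inj_on_def by (metis Pair_inject atLeastAtMost_iff linorder_neqE_nat)
    let ?L = "L - (b - a)"
    have "mpow A L $ i $ j \<le> mpow A ?L $ i $ j"
      using wwt_remove[of a b L w] wwt_cut_le_mpow[of a b L w A] w ab by simp
    moreover have "?L mod g = L mod g"
    proof -
      have "g dvd b - a" using ab by (metis less_imp_le_nat mod_eq_dvd_iff_nat)
      moreover have "L = ?L + (b - a)" using ab by simp
      ultimately show ?thesis by (metis dvd_eq_mod_eq_0 mod_add_right_eq add.right_neutral)
    qed
    moreover have "?L < L" using ab by linarith
    ultimately obtain L' where "L' < CARD('n) * g" "L' mod g = L mod g"
      "mpow A ?L $ i $ j \<le> mpow A L' $ i $ j" "mpow A L $ i $ j \<le> mpow A ?L $ i $ j"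
      using less[of ?L] by metis
    then show ?thesis by (meson order_trans)
  qed auto
qed

end

section \<open>Shortening walks that have to meet a given cycle\<close>

lemma card_eq_sum_positions:
  fixes w :: "nat \<Rightarrow> 'n::finite"
  shows "Suc L = (\<Sum>v\<in>UNIV. card {k \<in> {..L}. w k = v})"
proof -
  have "card (\<Union>v\<in>UNIV. {k \<in> {..L}. w k = v}) = (\<Sum>v\<in>UNIV. card {k \<in> {..L}. w k = v})"
    by (rule card_UN_disjoint) auto
  moreover have "(\<Union>v\<in>UNIV. {k \<in> {..L}. w k = v}) = {..L}" by auto
  ultimately show ?thesis by simp
qed

lemma mod_diff_eq_0:
  fixes x y m :: nat
  assumes "x \<le> y" "x mod m = y mod m" shows "m dvd y - x"
  using assms by (metis mod_eq_dvd_iff_nat)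

context definite
begin

text \<open>
  The heart of the transience bound.  Cut the walk at its first visit to \<open>Z\<close>: then a node of \<open>Z\<close>
  occurs only in the second part, so \<open>card Z + 1\<close> occurrences of it leave a removable closed
  subwalk, while any other node may need \<open>card Z + 2\<close> occurrences.
\<close>

lemma via_reduce_step:
  fixes Z :: "'n set"
  defines "l \<equiv> card Z"
  assumes uZ: "u \<in> Z" and big: "CARD('n) * l + CARD('n) \<le> s + t + l"
    and nz: "mpow A s $ i $ u * mpow A t $ u $ j \<noteq> 0"
  shows "\<exists>u'\<in>Z. \<exists>s' t'. s' + t' < s + t \<and> (s' + t') mod l = (s + t) mod l \<and>
    mpow A s $ i $ u * mpow A t $ u $ j \<le> mpow A s' $ i $ u' * mpow A t' $ u' $ j"
proof -
  define L where "L = s + t"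
  have l0: "l > 0" using uZ by (auto simp: l_def card_gt_0_iff)
  obtain w where w: "w 0 = i" "w s = u" "w L = j"
    "mpow A s $ i $ u = wwt A w 0 s" "mpow A t $ u $ j = wwt A w s L"
    using ex_walk_via[OF nz] unfolding L_def by metis
  have val: "mpow A s $ i $ u * mpow A t $ u $ j = wwt A w 0 L"
    using wwt_split[of 0 s L A w] w by (simp add: L_def)
  define z where "z = (LEAST k. w k \<in> Z)"
  have zZ: "w z \<in> Z" using uZ w(2) unfolding z_def by (metis LeastI)
  have "z \<le> s" unfolding z_def using uZ w(2) by (auto intro: Least_le)
  then have zL: "z \<le> L" by (simp add: L_def)
  have first: "z \<le> k" if "w k \<in> Z" for k unfolding z_def using that by (rule Least_le)

  \<comment> \<open>One closed subwalk before \<open>z\<close> and one after it are deleted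
    together. Either may be empty, and only their combined length has to be a positive multiple of
    \<open>l\<close>. The visit to \<open>Z\<close> at \<open>z\<close> survives.\<close>
  have cut: ?thesis if *: "a \<le> b" "b \<le> z" "z \<le> c" "c \<le> d" "d \<le> L" "w a = w b" "w c = w d"
    "0 < b - a + (d - c)" "l dvd b - a + (d - c)" for a b c d
  proof -
    have "wwt A w 0 L = wwt A w 0 z * wwt A w z L" using zL by (intro wwt_split) auto
    also have "wwt A w 0 z \<le> wwt A w 0 a * wwt A w b z" using * by (intro wwt_remove) auto
    also have "\<dots> \<le> mpow A (z - (b - a)) $ i $ w z"
      using wwt_cut_le_mpow[of a b z w A] * w by simp
    finally have 1: "wwt A w 0 L \<le> mpow A (z - (b - a)) $ i $ w z * wwt A w z L"
      by (simp add: rmax_mult_mono)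
    have "wwt A w z L = wwt A w z c * (wwt A w c d * wwt A w d L)"
      using * wwt_split[of z c L A w] wwt_split[of c d L A w] by simp
    also have "\<dots> \<le> mpow A (c - z) $ w z $ w c * (1 * mpow A (L - d) $ w c $ w L)"
      using * wwt_le_mpow[of d L A w] wwt_le_mpow[of z c A w] wwt_closed_le_1[of c d w]
      by (intro rmax_mult_mono) simp_all
    also have "\<dots> \<le> mpow A (c - z + (L - d)) $ w z $ j"
      using w mpow_ge by simp
    finally have 2: "wwt A w z L \<le> mpow A (c - z + (L - d)) $ w z $ j" .
    define r where "r = b - a + (d - c)"
    have r: "L = z - (b - a) + (c - z + (L - d)) + r" using * by (simp add: r_def)
    have "mpow A s $ i $ u * mpow A t $ u $ j
        \<le> mpow A (z - (b - a)) $ i $ w z * mpow A (c - z + (L - d)) $ w z $ j"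
      using order_trans[OF 1 rmax_mult_mono[OF order_refl 2]] val by simp
    moreover have "z - (b - a) + (c - z + (L - d)) < L" using r *(8) by (simp add: r_def)
    moreover have "(z - (b - a) + (c - z + (L - d))) mod l = L mod l"
    proof -
      obtain q where "r = l * q" using *(9) unfolding r_def by blast
      then show ?thesis by (subst r) simp
    qed
    ultimately show ?thesis using zZ unfolding L_def by blast
  qed

  \<comment> \<open>\<open>b v\<close> is the number of occurrences of \<open>v\<close> that are
    tolerated. The total is \<open>n * l + n - l\<close>, which \<open>big\<close> bounds by
    \<open>L\<close>, while the walk has \<open>L + 1\<close> positions; so some node exceeds its
    allowance.\<close>
  define b where "b v = (if v \<in> Z then l else Suc l)" for v
  have "(\<Sum>v\<in>UNIV. b v) < Suc L"
  proof -
    have "(\<Sum>v\<in>UNIV. b v) = (\<Sum>v\<in>Z. b v) + (\<Sum>v\<in>-Z. b v)"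
      by (metis Compl_eq_Diff_UNIV finite_class.finite_UNIV subset_UNIV sum.subset_diff add.commute)
    also have "\<dots> = l * l + (CARD('n) - l) * Suc l"
      by (simp add: b_def l_def Compl_eq_Diff_UNIV card_Diff_subset)
    also have "\<dots> + l = CARD('n) * l + CARD('n)"
    proof -
      have "l \<le> CARD('n)" unfolding l_def by (rule card_mono) auto
      then obtain m where "CARD('n) = l + m" by (metis le_Suc_ex)
      then show ?thesis by (simp add: algebra_simps)
    qed
    finally show ?thesis using big by (simp add: L_def)
  qed
  then have "\<exists>v. b v < card {k \<in> {..L}. w k = v}"
    unfolding card_eq_sum_positions[of L w] by (meson not_le sum_mono)
  then obtain v where v: "b v < card {k \<in> {..L}. w k = v}" by blast
  define P where "P = {k. k < z \<and> w k = v}"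
  define Q where "Q = {k. z \<le> k \<and> k \<le> L \<and> w k = v}"
  have fin: "finite P" "finite Q" by (auto simp: P_def Q_def)
  have "{k \<in> {..L}. w k = v} = P \<union> Q" "P \<inter> Q = {}" using zL by (auto simp: P_def Q_def)
  then have PQ: "card P + card Q > b v" using v fin by (simp add: card_Un_disjoint)
  have "b v \<ge> l" by (simp add: b_def)
  have "b v = Suc l" if ne: "P \<noteq> {}"
  proof -
    obtain k where "k < z" "w k = v" using ne by (auto simp: P_def)
    then have "v \<notin> Z" using first[of k] by auto
    then show ?thesis by (simp add: b_def)
  qed
  then consider "card P > l" | "card Q > l" | "P \<noteq> {}" "Q \<noteq> {}" "card P + card Q > Suc l"
    using PQ \<open>b v \<ge> l\<close> by (cases "P = {}"; cases "Q = {}") auto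
  then show ?thesis
  proof cases
    case 1
    obtain x y where "x \<in> P" "y \<in> P" "x < y" "id x mod l = id y mod l"
      using pigeonhole_mod[OF l0 fin(1) 1] by metis
    then show ?thesis using cut[of x y L L] zL mod_diff_eq_0[of x y l] by (auto simp: P_def)
  next
    case 2
    obtain x y where "x \<in> Q" "y \<in> Q" "x < y" "id x mod l = id y mod l"
      using pigeonhole_mod[OF l0 fin(2) 2] by metis
    then show ?thesis using cut[of 0 0 x y] mod_diff_eq_0[of x y l] by (auto simp: Q_def)
  next
    case 3
    define p where "p = Max P"
    define q where "q = Min Q"
    have p: "p \<in> P" "\<And>k. k \<in> P \<Longrightarrow> k \<le> p" using 3 fin by (auto simp: p_def)
    have q: "q \<in> Q" "\<And>k. k \<in> Q \<Longrightarrow> q \<le> k" using 3 fin by (auto simp: q_def)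
    have pz: "p < z" "z \<le> q" "q \<le> L" "w p = v" "w q = v" using p q by (auto simp: P_def Q_def)
    \<comment> \<open>\<open>f\<close> measures positions with the segment from \<open>p\<close> to
      \<open>q\<close> left out, identifying \<open>q\<close> with \<open>p\<close>; hence
      \<open>q\<close> is dropped from the index set. For \<open>x\<close> before \<open>z\<close>
      and \<open>y\<close> after it, \<open>f y - f x\<close> is the total length of the two closed
      subwalks from \<open>x\<close> to \<open>p\<close> and from \<open>q\<close> to
      \<open>y\<close>.\<close>
    define f where "f k = (if k < z then k else p + (k - q))" for k
    have "card (P \<union> (Q - {q})) = card P + (card Q - 1)"
      using fin q(1) by (subst card_Un_disjoint) (auto simp: P_def Q_def)
    then have "card (P \<union> (Q - {q})) > l"
      using 3(3) q(1) fin by (simp add: card_gt_0_iff)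
    then obtain x y where xy: "x \<in> P \<union> (Q - {q})" "y \<in> P \<union> (Q - {q})" "x < y" "f x mod l = f y mod l"
      using pigeonhole_mod[OF l0 _, of "P \<union> (Q - {q})" f] fin by auto
    consider "y \<in> P" | "x \<in> Q" | "x \<in> P" "y \<in> Q - {q}" using xy by blast
    then show ?thesis
    proof cases
      case 1
      then have "x \<in> P" using xy by (auto simp: P_def Q_def)
      with 1 show ?thesis using cut[of x y L L] zL xy mod_diff_eq_0[of x y l]
        by (auto simp: P_def f_def)
    next
      case 2
      then have "y \<in> Q" using xy by (auto simp: P_def Q_def)
      have "q \<le> x" using 2 q by simp
      have "l dvd f y - f x" using mod_diff_eq_0[of "f x" "f y" l] xy 2 \<open>y \<in> Q\<close>
        by (auto simp: f_def Q_def)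
      moreover have "f y - f x = y - x" using 2 \<open>y \<in> Q\<close> \<open>q \<le> x\<close> xy by (auto simp: f_def Q_def)
      ultimately show ?thesis using 2 \<open>y \<in> Q\<close> cut[of 0 0 x y] xy by (auto simp: Q_def)
    next
      case 3
      have "q < y" using 3 q by (metis DiffE le_neq_implies_less singletonI)
      have "x \<le> p" using p 3 by simp
      have fxy: "f x = x" "f y = p + (y - q)" using 3 by (auto simp: f_def P_def Q_def)
      then have "l dvd f y - f x" using mod_diff_eq_0[of "f x" "f y" l] xy \<open>x \<le> p\<close> by simp
      moreover have "f y - f x = p - x + (y - q)" using fxy \<open>x \<le> p\<close> by simp
      ultimately show ?thesis using 3 cut[of x p q y] \<open>x \<le> p\<close> \<open>q < y\<close> pz by (auto simp: P_def Q_def)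
    qed
  qed
qed

text \<open>The reduction is iterated. The node of \<open>Z\<close> at which the walk is split may
  change each time, so only its membership in \<open>Z\<close> is kept. If the product is
  \<open>0\<close>, the residue of \<open>s + t\<close> itself serves as the short length.\<close>

lemma via_reduce:
  assumes "u \<in> Z"
  shows "\<exists>u'\<in>Z. \<exists>s' t'. s' + t' + card Z < CARD('n) * card Z + CARD('n) \<and>
    (s' + t') mod card Z = (s + t) mod card Z \<and>
    mpow A s $ i $ u * mpow A t $ u $ j \<le> mpow A s' $ i $ u' * mpow A t' $ u' $ j"
  using assms
proof (induction "s + t" arbitrary: s t u rule: less_induct)
  case less
  have c: "0 < card Z" "card Z \<le> CARD('n)"
    using less.prems by (auto simp: card_gt_0_iff intro: card_mono)
  consider "s + t + card Z < CARD('n) * card Z + CARD('n)"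
    | "mpow A s $ i $ u * mpow A t $ u $ j = 0"
    | "CARD('n) * card Z + CARD('n) \<le> s + t + card Z" "mpow A s $ i $ u * mpow A t $ u $ j \<noteq> 0"
    by linarith
  then show ?case
  proof cases
    case 1
    then show ?thesis using less.prems by blast
  next
    case 2
    have "(s + t) mod card Z < card Z" using c by simp
    moreover have "card Z \<le> CARD('n) * card Z" by simp
    ultimately have "(s + t) mod card Z + card Z < CARD('n) * card Z + CARD('n)" using c by linarith
    then show ?thesis using 2 less.prems
      by (intro bexI[of _ u] exI[of _ "(s + t) mod card Z"] exI[of _ 0]) auto
  next
    case 3
    obtain u' s' t' where *: "u' \<in> Z" "s' + t' < s + t" "(s' + t') mod card Z = (s + t) mod card Z"
      "mpow A s $ i $ u * mpow A t $ u $ j \<le> mpow A s' $ i $ u' * mpow A t' $ u' $ j"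
      using via_reduce_step[OF less.prems 3] by blast
    obtain u2 s2 t2 where "u2 \<in> Z" "s2 + t2 + card Z < CARD('n) * card Z + CARD('n)"
      "(s2 + t2) mod card Z = (s' + t') mod card Z"
      "mpow A s' $ i $ u' * mpow A t' $ u' $ j \<le> mpow A s2 $ i $ u2 * mpow A t2 $ u2 $ j"
      using less.hyps[OF *(2,1)] by blast
    then show ?thesis using * order_trans[OF *(4)] by metis
  qed
qed

lemma mpow_closed_ge_1:
  assumes "1 \<le> mpow A l $ u $ u" shows "1 \<le> mpow A (l * q) $ u $ u"
proof (induction q)
  case (Suc q)
  have "1 * 1 \<le> mpow A l $ u $ u * mpow A (l * q) $ u $ u"
    using assms Suc by (rule rmax_mult_mono)
  also have "\<dots> \<le> mpow A (l * Suc q) $ u $ u" by (simp add: mpow_ge)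
  finally show ?case by simp
qed (simp add: mat_def)

text \<open>The hypothesis on \<open>t\<close> is \<open>(n - 2) * l + n \<le> t\<close> without
  subtraction, where \<open>l\<close> is \<open>card Z\<close>. It makes the reduced length smaller
  than \<open>t + l\<close>; being congruent to \<open>t\<close>, this length is at most
  \<open>t\<close>. The missing multiple of \<open>l\<close> is filled with laps of weight at least
  \<open>1\<close> at the node of \<open>Z\<close>.\<close>

lemma via_bound:
  assumes Z: "\<And>u. u \<in> Z \<Longrightarrow> 1 \<le> mpow A (card Z) $ u $ u" and u: "u \<in> Z"
    and t: "CARD('n) * card Z + CARD('n) \<le> t + 2 * card Z"
    and cong: "(r + s) mod card Z = t mod card Z"
  shows "mpow A r $ i $ u * mpow A s $ u $ j \<le> mpow A t $ i $ j"
proof -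
  let ?l = "card Z"
  obtain u' r' s' where *: "u' \<in> Z" "r' + s' + ?l < CARD('n) * ?l + CARD('n)"
    "(r' + s') mod ?l = (r + s) mod ?l"
    "mpow A r $ i $ u * mpow A s $ u $ j \<le> mpow A r' $ i $ u' * mpow A s' $ u' $ j"
    using via_reduce[OF u] by blast
  have lt: "r' + s' < t + ?l" using *(2) t by linarith
  have le: "r' + s' \<le> t"
  proof (rule ccontr)
    assume "\<not> r' + s' \<le> t"
    moreover from this have "?l dvd r' + s' - t" using *(3) cong mod_diff_eq_0[of t "r' + s'"] by simp
    ultimately have "?l \<le> r' + s' - t" by (intro dvd_imp_le) auto
    then show False using lt \<open>\<not> r' + s' \<le> t\<close> by linarith
  qed
  have "?l dvd t - (r' + s')" using le *(3) cong mod_diff_eq_0[of "r' + s'" t] by simp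
  then obtain q where q: "t - (r' + s') = ?l * q" by blast
  have "mpow A r' $ i $ u' * mpow A s' $ u' $ j
      \<le> mpow A r' $ i $ u' * (mpow A (?l * q) $ u' $ u' * mpow A s' $ u' $ j)"
    using rmax_mult_ge_left[OF mpow_closed_ge_1[OF Z[OF *(1)]], of _ q]
    by (simp add: rmax_mult_mono mult.commute)
  also have "\<dots> \<le> mpow A r' $ i $ u' * mpow A (?l * q + s') $ u' $ j"
    by (intro rmax_mult_mono mpow_ge) simp
  also have "\<dots> \<le> mpow A (r' + (?l * q + s')) $ i $ j" by (rule mpow_ge)
  also have "r' + (?l * q + s') = t" using q le by linarith
  finally show ?thesis using *(4) by (rule order_trans[rotated])
qed

end

section \<open>Wielandt's argument for a Hamiltonian critical cycle\<close>

context definite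
begin

lemma simple_closed_le_1: "simple_closed A V y \<Longrightarrow> y \<le> 1"
proof -
  assume *: "simple_closed A V y"
  then obtain v where "v \<in> V" using simple_closed_pos[OF *] by (auto simp: card_gt_0_iff)
  from vwalk_le_mpow[OF simple_closed_vwalk[OF * this]] closed_le_1 show ?thesis
    by (rule order_trans)
qed

lemma mprod_le_1: "simple_cycles A M \<Longrightarrow> mprod M \<le> 1"
  by (induction M) (auto intro: order_trans[OF rmax_mult_mono[of _ 1 _ 1]] simple_closed_le_1)

end

text \<open>Among the \<open>n + 1\<close> prefix sums of an enumeration of \<open>M\<close> two
  agree modulo \<open>n\<close>; the block between them is the required submultiset.\<close>

lemma submultiset_sum_dvd:
  fixes f :: "'b \<Rightarrow> nat"
  assumes "n > 0" "n \<le> size M"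
  shows "\<exists>N. N \<subseteq># M \<and> N \<noteq> {#} \<and> n dvd (\<Sum>c\<in>#N. f c)"
proof -
  obtain xs where xs: "mset xs = M" using ex_mset by blast
  define g where "g k = sum_list (map f (take k xs))" for k
  obtain x y where xy: "x \<le> n" "y \<le> n" "x < y" "g x mod n = g y mod n"
    using pigeonhole_mod[OF assms(1), of "{..n}" g] by auto
  define ys where "ys = drop x (take y xs)"
  have tk: "take y xs = take x xs @ ys"
    unfolding ys_def using append_take_drop_id[of x "take y xs"] xy by (simp add: min_def)
  have "g y = g x + sum_list (map f ys)" unfolding g_def tk by simp
  then have "n dvd sum_list (map f ys)"
    using mod_diff_eq_0[of "g x" "g y" n] xy by simp
  moreover have "length ys = y - x" using xs xy assms(2) by (auto simp: ys_def)
  moreover have "mset ys \<subseteq># M"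
    using xs append_take_drop_id[of y xs] tk by (metis mset_append mset_subset_eq_add_left mset_subset_eq_add_right subset_mset.trans)
  ultimately show ?thesis using xy
    by (intro exI[of _ "mset ys"]) (auto simp flip: sum_mset_sum_list)
qed

context definite
begin

text \<open>Discarding cycles does not lower the product, as every factor is at most
  \<open>1\<close>. When no further submultiset can be discarded, \<open>submultiset_sum_dvd\<close>
  leaves fewer than \<open>n\<close> cycles.\<close>

lemma remove_zero_sums:
  assumes "n > 0" "simple_cycles A M"
  shows "\<exists>N. simple_cycles A N \<and> msum N mod n = msum M mod n \<and> mprod M \<le> mprod N \<and>
    (\<forall>K. K \<subseteq># N \<longrightarrow> K \<noteq> {#} \<longrightarrow> \<not> n dvd msum K)"
  using assms(2)
proof (induction M rule: measure_induct_rule[of size])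
  case (less M)
  show ?case
  proof (cases "\<exists>K. K \<subseteq># M \<and> K \<noteq> {#} \<and> n dvd msum K")
    case True
    then obtain K where K: "K \<subseteq># M" "K \<noteq> {#}" "n dvd msum K" by blast
    define N where "N = M - K"
    have M: "M = N + K" using K by (simp add: N_def)
    have "simple_cycles A N" "simple_cycles A K" using less.prems unfolding M by auto
    then have "mprod M \<le> mprod N" using mprod_le_1 unfolding M by (auto intro: rmax_mult_le_left)
    moreover have "msum N mod n = msum M mod n"
      using K(3) unfolding M by (auto simp: mod_add_eq[symmetric])
    moreover have "size N < size M" using K(2) unfolding M by (simp add: nonempty_has_size)
    ultimately obtain N' where "simple_cycles A N'" "msum N' mod n = msum M mod n"
      "mprod N \<le> mprod N'" "\<forall>K. K \<subseteq># N' \<longrightarrow> K \<noteq> {#} \<longrightarrow> \<not> n dvd msum K" "mprod M \<le> mprod N"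
      using less.IH[of N] \<open>simple_cycles A N\<close> by auto
    then show ?thesis by (intro exI[of _ N']) auto
  qed (use less.prems in blast)
qed

lemma msum_le: "(\<And>c. c \<in># M \<Longrightarrow> card (fst c) \<le> b) \<Longrightarrow> msum M \<le> size M * b"
  by (induction M) (auto simp: add_mono)

text \<open>
  Wielandt's argument.  Reinserting the cycles into the path needs connectedness, which is bought
  with one copy of the closed walk through all nodes unless a cycle of length \<open>n - 1\<close> already
  meets the path and all other cycles.
\<close>

lemma hamiltonian_reduce:
  fixes i j :: 'n
  defines "n \<equiv> CARD('n)"
  assumes H: "vwalk A i i n h UNIV" "1 \<le> h" and n2: "n \<ge> 2"
  shows "\<exists>L' \<le> n * (n - 1) + 1. L' mod n = L mod n \<and> mpow A L $ i $ j \<le> mpow A L' $ i $ j"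
proof (cases "mpow A L $ i $ j = 0")
  case True
  have "L mod n < n" using n2 by simp
  also have "n \<le> n * (n - 1)" using n2 by simp
  finally show ?thesis using True by (intro exI[of _ "L mod n"]) auto
next
  case False
  obtain p x X M where dec: "vwalk A i j p x X" "p = 0 \<or> i \<noteq> j" "p < n" "simple_cycles A M"
    "p + msum M = L" "mpow A L $ i $ j \<le> x * mprod M"
    using cycle_decomposition[OF False] unfolding n_def by blast
  obtain N where N: "simple_cycles A N" "msum N mod n = msum M mod n" "mprod M \<le> mprod N"
    "\<And>K. K \<subseteq># N \<Longrightarrow> K \<noteq> {#} \<Longrightarrow> \<not> n dvd msum K"
    using remove_zero_sums[OF _ dec(4), of n] n2 by auto
  have size: "size N \<le> n - 1"
    using submultiset_sum_dvd[of n N "\<lambda>c. card (fst c)"] N(4) n2 by (cases "n \<le> size N") auto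
  have cardN: "0 < card (fst c) \<and> card (fst c) \<le> n - 1" if c: "c \<in># N" for c
  proof -
    have "card (fst c) \<le> n" unfolding n_def by (rule card_mono) auto
    \<comment> \<open>A Hamiltonian cycle would alone be a submultiset with length divisible by
      \<open>n\<close>.\<close>
    moreover have "card (fst c) \<noteq> n" using N(4)[of "{#c#}"] c by auto
    ultimately show ?thesis using simple_closed_pos[of A "fst c" "snd c"] N(1) c by auto
  qed
  have Lmod: "(p + msum N) mod n = L mod n"
    using dec(5) N(2) by (metis mod_add_right_eq)
  have val: "mpow A L $ i $ j \<le> x * mprod N"
    using dec(6) rmax_mult_mono[OF order_refl[of x] N(3)] by (rule order_trans)
  have sq: "n + (n - 1) * (n - 1) = n * (n - 1) + 1"
    using n2 by (cases n) auto
  show ?thesis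
  \<comment> \<open>In the first case a Hamiltonian lap is affordable: the length is at most
    \<open>n + (n - 1) * (n - 1)\<close> if the path is empty, and at most
    \<open>n + (n - 1) + (n - 1) * (n - 2)\<close>, the same number, if all cycles are shorter than
    \<open>n - 1\<close>. In the other case a cycle of length \<open>n - 1\<close> takes over the
    role of the lap.\<close>
  proof (cases "p = 0 \<or> (\<forall>c\<in>#N. card (fst c) \<le> n - 2)")
    case True
    have "vwalk A i j (n + p) (h * x) (UNIV \<union> X)"
      by (rule vwalk_append[OF dec(1) H(1)])
    then have "vwalk A i j (n + p) (h * x) UNIV" by simp
    moreover have "fst c \<inter> UNIV \<noteq> {}" if "c \<in># N" for c
      using cardN[OF that] by auto
    ultimately obtain Y where "vwalk A i j (n + p + msum N) (h * x * mprod N) Y"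
      using vwalk_insert_cycles[OF N(1)] by blast
    from vwalk_le_mpow[OF this] have "x * mprod N \<le> mpow A (n + p + msum N) $ i $ j"
      using rmax_mult_ge_left[OF H(2), of "x * mprod N"] by (simp add: mult_ac)
    moreover have "n + p + msum N \<le> n * (n - 1) + 1"
    proof (cases "p = 0")
      case True
      have "msum N \<le> size N * (n - 1)" using cardN by (intro msum_le) auto
      also have "\<dots> \<le> (n - 1) * (n - 1)" using size by (rule mult_right_mono) simp
      finally show ?thesis using True sq by simp
    next
      case False
      with True have "msum N \<le> size N * (n - 2)" by (intro msum_le) auto
      also have "\<dots> \<le> (n - 1) * (n - 2)" using size by (rule mult_right_mono) simp
      finally have "n + p + msum N \<le> n + (n - 1) + (n - 1) * (n - 2)" using dec(3) by linarith
      also have "\<dots> = n + (n - 1) * (n - 1)"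
        using n2 by (cases n; cases "n - 1") auto
      finally show ?thesis using sq by simp
    qed
    ultimately show ?thesis using val Lmod
      by (intro exI[of _ "n + p + msum N"]) (auto simp: add.assoc)
  next
    case False
    then obtain c where c: "c \<in># N" "card (fst c) > n - 2" and ij: "i \<noteq> j" using dec(2) by auto
    then have cc: "card (fst c) = n - 1" using cardN[OF c(1)] by linarith
    then have "card (- fst c) = 1"
      using n2 by (simp add: n_def Compl_eq_Diff_UNIV card_Diff_subset)
    then obtain z where z: "- fst c = {z}" by (auto simp: card_1_singleton_iff)
    define N' where "N' = N - {#c#}"
    have NN: "N = add_mset c N'" using c by (simp add: N'_def)
    \<comment> \<open>\<open>c\<close> misses only the node \<open>z\<close>, and the distinct nodes
      \<open>i\<close> and \<open>j\<close> cannot both be \<open>z\<close>; so \<open>c\<close>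
      meets the path.\<close>
    have "i \<in> fst c \<or> j \<in> fst c" using z ij by (metis ComplI singletonD)
    then obtain v where v: "v \<in> fst c" "v \<in> X" using vwalk_ends[OF dec(1)] by blast
    have "vwalk A v v (n - 1) (snd c) (fst c)"
      using simple_closed_vwalk[of A "fst c" "snd c" v] N(1) c v cc by auto
    from vwalk_insert[OF dec(1) v(2) this]
    have W: "vwalk A i j (p + (n - 1)) (x * snd c) (X \<union> fst c)" .
    \<comment> \<open>A cycle avoiding \<open>c\<close> could only be a loop at \<open>z\<close>;
      together with \<open>c\<close> it would have total length \<open>n\<close>, which was
      excluded.\<close>
    have "fst d \<inter> (X \<union> fst c) \<noteq> {}" if d: "d \<in># N'" for d
    proof
      assume "fst d \<inter> (X \<union> fst c) = {}"
      then have "fst d \<subseteq> {z}" using z by blast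
      then have "card (fst d) \<le> card {z}" by (intro card_mono) auto
      then have "card (fst d) = 1" using cardN[of d] d NN by auto
      then have "msum {#c, d#} = n" using cc n2 by simp
      moreover have "{#c, d#} \<subseteq># N" using d NN by simp
      ultimately show False using N(4)[of "{#c, d#}"] by (metis dvd_refl add_mset_not_empty)
    qed
    then obtain Y where "vwalk A i j (p + (n - 1) + msum N') (x * snd c * mprod N') Y"
      using vwalk_insert_cycles[OF _ _ W, of N'] N(1) NN by auto
    from vwalk_le_mpow[OF this] have "x * mprod N \<le> mpow A (p + msum N) $ i $ j"
      using cc unfolding NN by (simp add: mult_ac add_ac)
    moreover have "p + msum N \<le> n * (n - 1) + 1"
    proof -
      have "msum N \<le> size N * (n - 1)" using cardN by (intro msum_le) auto
      also have "\<dots> \<le> (n - 1) * (n - 1)" using size by (rule mult_right_mono) simp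
      finally show ?thesis using dec(3) sq by linarith
    qed
    ultimately show ?thesis using val Lmod by (intro exI[of _ "p + msum N"]) auto
  qed
qed

text \<open>Since \<open>n * (n - 1) + 1 = n + (n - 1) * (n - 1)\<close>, the reduced length is
  below \<open>t + n\<close>; by congruence it is at most \<open>t\<close>, and laps of the
  Hamiltonian cycle at \<open>i\<close> restore the length \<open>t\<close>.\<close>

lemma hamiltonian_bound:
  fixes i j :: 'n
  assumes H: "\<And>v. \<exists>h. vwalk A v v CARD('n) h UNIV \<and> 1 \<le> h" and n2: "CARD('n) \<ge> 2"
    and t: "t \<ge> (CARD('n) - 1) * (CARD('n) - 1) + 1" and cong: "L mod CARD('n) = t mod CARD('n)"
  shows "mpow A L $ i $ j \<le> mpow A t $ i $ j"
proof -
  let ?n = "CARD('n)"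
  obtain h where h: "vwalk A i i ?n h UNIV" "1 \<le> h" using H by blast
  obtain L' where L': "L' \<le> ?n * (?n - 1) + 1" "L' mod ?n = L mod ?n" "mpow A L $ i $ j \<le> mpow A L' $ i $ j"
    using hamiltonian_reduce[OF h n2] by blast
  have "?n * (?n - 1) + 1 = ?n + (?n - 1) * (?n - 1)" using n2 by (cases ?n) auto
  then have lt: "L' < t + ?n" using L' t by linarith
  have le: "L' \<le> t"
  proof (rule ccontr)
    assume gt: "\<not> L' \<le> t"
    then have "?n dvd L' - t" using L'(2) cong mod_diff_eq_0[of t L' ?n] by simp
    then have "?n \<le> L' - t" using gt by (intro dvd_imp_le) auto
    then show False using lt gt by linarith
  qed
  have "?n dvd t - L'" using le L'(2) cong mod_diff_eq_0[of L' t ?n] by simp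
  then obtain q where q: "t - L' = ?n * q" by blast
  have "1 \<le> mpow A ?n $ i $ i" using vwalk_le_mpow[OF h(1)] h(2) by (rule order_trans[rotated])
  then have "mpow A L' $ i $ j \<le> mpow A (?n * q) $ i $ i * mpow A L' $ i $ j"
    using rmax_mult_ge_left[OF mpow_closed_ge_1, of ?n i "mpow A L' $ i $ j" q] by (simp add: mult.commute)
  also have "\<dots> \<le> mpow A (?n * q + L') $ i $ j" by (rule mpow_ge)
  also have "?n * q + L' = t" using q le by linarith
  finally show ?thesis using L'(3) by (rule order_trans[rotated])
qed

end

section \<open>Cycles of maximal mean and potentials\<close>

lemma mat_digraph_simps [simp]:
  "verts (mat_digraph A) = UNIV" "arcs (mat_digraph A) = {(i, j). A $ i $ j \<noteq> 0}"
  "tail (mat_digraph A) = fst" "head (mat_digraph A) = snd"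
  by (simp_all add: mat_digraph_def)

lemma wf_mat_digraph: "wf_digraph (mat_digraph A)"
  by unfold_locales auto

lemma periodic_fun_mod:
  fixes w :: "nat \<Rightarrow> 'a"
  assumes "\<And>k. w (k + l) = w k" shows "w (k mod l) = w k"
proof -
  have "w (m + q * l) = w m" for m q
    by (induction q) (simp_all add: assms add.assoc[symmetric] add.commute[of l])
  from this[of "k mod l" "k div l"] show ?thesis by (simp add: mult.commute)
qed

lemma periodic_fun_eq_iff:
  fixes w :: "nat \<Rightarrow> 'a"
  assumes "\<And>k. w (k + l) = w k" "inj_on w {0..<l}" "0 < l"
  shows "w a = w b \<longleftrightarrow> a mod l = b mod l"
proof -
  have "w (a mod l) = w (b mod l) \<longleftrightarrow> a mod l = b mod l"
    by (rule inj_on_eq_iff[OF assms(2)]) (use assms(3) in auto)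
  then show ?thesis by (simp add: periodic_fun_mod[of w l, OF assms(1)])
qed

lemma cas_fst_snd:
  assumes "tail G = fst" "head G = snd" "pre_digraph.cas G u p v" "p \<noteq> []"
  shows "fst (p ! 0) = u \<and> snd (p ! (length p - 1)) = v \<and>
    (\<forall>k. Suc k < length p \<longrightarrow> snd (p ! k) = fst (p ! Suc k))"
  using assms(3,4)
proof (induction p arbitrary: u)
  case (Cons e p)
  show ?case
  proof (cases "p = []")
    case False
    have "pre_digraph.cas G (snd e) p v" and e: "fst e = u"
      using Cons.prems assms(1,2) by (auto simp: pre_digraph.cas.simps)
    note IH = Cons.IH[OF this(1) False]
    have "snd ((e # p) ! k) = fst ((e # p) ! Suc k)" if "Suc k < length (e # p)" for k
      using IH that by (cases k) auto
    then show ?thesis using e IH False by (auto simp: nth_Cons')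
  qed (use Cons.prems assms(1,2) in \<open>auto simp: pre_digraph.cas.simps\<close>)
qed simp

text \<open>Translates an arc list into a periodic function on all naturals, so that going around
  the cycle needs no special case at its end.\<close>

lemma cycle_fun:
  assumes "mat_cycle A p"
  shows "\<exists>w. 0 < length p \<and> inj_on w {0..<length p} \<and> (\<forall>k. w (k + length p) = w k) \<and>
    p = map (\<lambda>k. (w k, w (Suc k))) [0..<length p] \<and> (\<forall>k. A $ w k $ w (Suc k) \<noteq> 0)"
proof -
  let ?G = "mat_digraph A" and ?l = "length p"
  interpret wf_digraph ?G by (rule wf_mat_digraph)
  obtain u where u: "awalk u p u" "distinct (tl (awalk_verts u p))" and ne: "p \<noteq> []"
    using assms by (auto simp: cycle_def)
  have cas: "cas u p u" and arcs: "\<And>e. e \<in> set p \<Longrightarrow> A $ fst e $ snd e \<noteq> 0"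
    using u(1) by (auto simp: awalk_def)
  note c = cas_fst_snd[OF mat_digraph_simps(3,4) cas ne]
  have "awalk_verts u p = map fst p @ [u]"
    using ne cas c by (simp add: awalk_verts_conv last_conv_nth)
  \<comment> \<open>\<open>cycle\<close> asks for distinct nodes after the first one only. As the
    walk is closed, the omitted start is also the last node, so all tails are distinct.\<close>
  then have "distinct (map fst (tl p) @ [u])"
    using u(2) ne by (cases p) auto
  then have dist: "distinct (map fst p)"
    using c ne by (cases p) auto
  define w where "w k = fst (p ! (k mod ?l))" for k
  have pos: "0 < ?l" using ne by simp
  have nth: "p ! k = (w k, w (Suc k))" if k: "k < ?l" for k
  proof (cases "Suc k < ?l")
    case True
    then show ?thesis using c k by (simp add: w_def prod_eq_iff)
  next
    case False
    then have "k = ?l - 1" using k by simp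
    then show ?thesis using c k pos by (simp add: w_def prod_eq_iff)
  qed
  have per: "w (k + ?l) = w k" for k by (simp add: w_def)
  have "inj_on w {0..<?l}"
  proof (rule inj_onI)
    fix a b assume "a \<in> {0..<?l}" "b \<in> {0..<?l}" "w a = w b"
    then show "a = b" using nth_eq_iff_index_eq[OF dist, of a b] by (simp add: w_def)
  qed
  moreover have "p = map (\<lambda>k. (w k, w (Suc k))) [0..<?l]"
    by (rule nth_equalityI) (auto simp: nth)
  moreover have "A $ w k $ w (Suc k) \<noteq> 0" for k
  proof -
    have "(w (k mod ?l), w (Suc (k mod ?l))) \<in> set p"
      using nth[of "k mod ?l"] nth_mem[of "k mod ?l" p] pos by auto
    moreover have "w (Suc (k mod ?l)) = w (Suc k)"
      using periodic_fun_mod[of w ?l, OF per] by (metis mod_Suc_eq)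
    ultimately show ?thesis using arcs periodic_fun_mod[of w ?l k, OF per] by fastforce
  qed
  ultimately show ?thesis using pos per by blast
qed

lemma cas_walk: "a \<le> b \<Longrightarrow> pre_digraph.cas (mat_digraph A) (w a) (map (\<lambda>k. (w k, w (Suc k))) [a..<b]) (w b)"
proof (induction a rule: inc_induct)
  case (step a)
  then show ?case by (simp add: upt_conv_Cons pre_digraph.cas.simps)
qed (simp add: pre_digraph.cas.simps)

lemma wwt_neq_0_iff: "wwt A w a b \<noteq> 0 \<longleftrightarrow> (\<forall>k\<in>{a..<b}. A $ w k $ w (Suc k) \<noteq> 0)"
proof (cases "a \<le> b")
  case True
  then show ?thesis
    by (induction b rule: dec_induct) (auto simp: wwt_Suc less_Suc_eq)
qed (simp add: wwt_def)

lemma fun_cycle: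
  assumes "0 < d" "inj_on w {0..<d}" "w d = w 0" "wwt A w 0 d \<noteq> 0"
  shows "mat_cycle A (map (\<lambda>k. (w k, w (Suc k))) [0..<d])" (is "mat_cycle A ?p")
proof -
  interpret wf_digraph "mat_digraph A" by (rule wf_mat_digraph)
  have cas: "cas (w 0) ?p (w 0)" using cas_walk[of 0 d A w] assms by simp
  then have aw: "awalk (w 0) ?p (w 0)"
    using assms by (auto simp: awalk_def wwt_neq_0_iff)
  have "awalk_verts (w 0) ?p = map w [0..<d] @ [w 0]"
    using assms by (simp add: awalk_verts_conv last_conv_nth comp_def)
  then have "tl (awalk_verts (w 0) ?p) = map w [1..<d] @ [w 0]"
    using assms(1) by (simp add: upt_conv_Cons)
  moreover have "distinct (map w [1..<d] @ [w 0])"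
  proof -
    have "w x \<noteq> w 0" if "1 \<le> x" "x < d" for x
      using inj_onD[OF assms(2), of x 0] that by auto
    then show ?thesis using assms(2) by (fastforce simp: distinct_map inj_on_def)
  qed
  ultimately show ?thesis using aw assms(1) by (auto simp: cycle_def)
qed

lemma cycle_length_le:
  fixes A :: "rmax^'n^'n"
  assumes "mat_cycle A p" shows "length p \<le> CARD('n)"
proof -
  obtain w :: "nat \<Rightarrow> 'n" where "inj_on w {0..<length p}" using cycle_fun[OF assms] by blast
  then have "card {0..<length p} \<le> CARD('n)" by (rule card_inj_on_le) auto
  then show ?thesis by simp
qed

lemma finite_cycles: "finite {p. mat_cycle A p}"
proof -
  have "{p. mat_cycle A p} \<subseteq> {p. set p \<subseteq> UNIV \<and> length p \<le> CARD('a)}"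
    using cycle_length_le by auto
  then show ?thesis by (rule finite_subset) (rule finite_lists_length_le, simp)
qed

lemma cycle_length_le_cr: "mat_cycle A p \<Longrightarrow> length p \<le> cr (mat_digraph A)"
  unfolding cr_def using finite_cycles[of A] by (intro Max_ge) (auto simp: setcompr_eq_image)

lemma mpow_smult: "mpow (smult_mat c A) t = smult_mat (c ^ t) (mpow A t)"
proof (induction t)
  case (Suc t)
  then show ?case
    by (simp add: smult_mat_def matrix_matrix_mult_def vec_eq_iff sum_distrib_left mult_ac)
qed (simp add: smult_mat_def vec_eq_iff)

lemma wwt_normalized:
  assumes "\<forall>k\<in>{0..<d}. A $ w k $ w (Suc k) \<noteq> 0"
  shows "wwt (normalized_mat A) w 0 d =
    Fin ((\<Sum>k<d. the_real (A $ w k $ w (Suc k))) - real d * max_cycle_mean A)"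
  using assms
proof (induction d)
  case (Suc d)
  then obtain r where "A $ w d $ w (Suc d) = Fin r" by (metis atLeastLessThan_iff lessI rmax_neq_0E zero_le)
  with Suc show ?case by (simp add: wwt_Suc normalized_mat_def smult_mat_def algebra_simps)
qed (simp add: one_rmax_def)

lemma mean_weight_map:
  "mean_weight A (map (\<lambda>k. (w k, w (Suc k))) [0..<d]) = (\<Sum>k<d. the_real (A $ w k $ w (Suc k))) / real d"
  by (simp add: mean_weight_def comp_def interv_sum_list_conv_sum_set_nat atLeast0LessThan)

text \<open>A simple cycle of length \<open>d\<close> has normalized weight \<open>d\<close> times
  the difference of its mean and the maximal mean. For an acyclic digraph every simple closed walk
  has weight \<open>0\<close>, so the unspecified value of \<open>max_cycle_mean\<close> does no
  harm.\<close>

lemma normalized_definite: "mpow (normalized_mat A) k $ v $ v \<le> 1"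
proof (rule definite_if_simple_cycles)
  fix V y assume "simple_closed (normalized_mat A) V y"
  then obtain w d where w: "0 < d" "inj_on w {0..<d}" "w d = w 0" "y = wwt (normalized_mat A) w 0 d"
    by (auto simp: simple_closed_def)
  show "y \<le> 1"
  proof (cases "y = 0")
    case False
    then have nz: "\<forall>k\<in>{0..<d}. A $ w k $ w (Suc k) \<noteq> 0"
      unfolding w(4) wwt_neq_0_iff by (auto simp: normalized_mat_def smult_mat_def)
    then have "mat_cycle A (map (\<lambda>k. (w k, w (Suc k))) [0..<d])"
      using w by (intro fun_cycle) (auto simp: wwt_neq_0_iff)
    then have "(\<Sum>k<d. the_real (A $ w k $ w (Suc k))) / real d \<le> max_cycle_mean A"
      unfolding max_cycle_mean_def mean_weight_map[symmetric]
      using finite_cycles[of A] by (intro Max_ge) (auto simp: setcompr_eq_image)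
    then show ?thesis
      unfolding w(4) wwt_normalized[OF nz] using w(1) by (simp add: one_rmax_def field_simps)
  qed simp
qed

lemma critical_cycle_wwt:
  assumes "critical_cycle A (map (\<lambda>k. (w k, w (Suc k))) [0..<d])" "0 < d"
    "\<forall>k. A $ w k $ w (Suc k) \<noteq> 0"
  shows "wwt (normalized_mat A) w 0 d = 1"
  using assms wwt_normalized[of d A w]
  by (simp add: critical_cycle_def mean_weight_map one_rmax_def field_simps)

lemma ex_critical_cycle:
  assumes "mat_cycle A p" shows "\<exists>q. critical_cycle A q"
proof -
  have "max_cycle_mean A \<in> {mean_weight A p | p. mat_cycle A p}"
    unfolding max_cycle_mean_def
    using finite_cycles[of A] assms by (intro Max_in) (auto simp: setcompr_eq_image)
  then show ?thesis by (auto simp: critical_cycle_def)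
qed

context definite
begin

text \<open>\<open>x i\<close> is the greatest weight of a walk starting at \<open>i\<close>.
  Lengths below \<open>n\<close> suffice for the maximum, the empty walk makes it finite, and
  prefixing an edge gives the inequality.\<close>

lemma ex_potential: "\<exists>x :: 'n \<Rightarrow> real. \<forall>i j. A $ i $ j * Fin (x j) \<le> Fin (x i)"
proof -
  define h where "h i = Max ((\<lambda>(k, j). mpow A k $ i $ j) ` ({..<CARD('n)} \<times> UNIV))" for i
  have ge: "mpow A k $ i $ j \<le> h i" for k i j
  proof -
    obtain k' where k': "k' < CARD('n)" "mpow A k $ i $ j \<le> mpow A k' $ i $ j"
      using mpow_reduce[of 1 k i j] by auto
    moreover have "mpow A k' $ i $ j \<le> h i"
      unfolding h_def using k' by (intro Max_ge) (auto intro!: image_eqI[of _ _ "(k', j)"])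
    ultimately show ?thesis by (meson order_trans)
  qed
  have att: "\<exists>k j. h i = mpow A k $ i $ j" for i
  proof -
    have "h i \<in> (\<lambda>(k, j). mpow A k $ i $ j) ` ({..<CARD('n)} \<times> UNIV)"
      unfolding h_def by (intro Max_in) (auto simp: lessThan_empty_iff)
    then show ?thesis by auto
  qed
  have "h i \<noteq> 0" for i
    using ge[of 0 i i] by (auto simp: mat_def one_rmax_def zero_rmax_def)
  then have h: "h i = Fin (the_real (h i))" for i by (metis rmax.sel rmax_neq_0E)
  have "A $ i $ j * h j \<le> h i" for i j
  proof -
    obtain k m where "h j = mpow A k $ j $ m" using att by blast
    then have "A $ i $ j * h j \<le> mpow A (Suc k) $ i $ m" using matrix_mul_ge[of A i j "mpow A k" m] by simp
    then show ?thesis using ge[of "Suc k" i m] order_trans by blast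
  qed
  then show ?thesis using h by (intro exI[of _ "\<lambda>i. the_real (h i)"]) metis
qed

end

lemma Fin_mult_cancel: "Fin a * u = Fin a * v \<longleftrightarrow> u = v"
  by (cases u; cases v) auto

text \<open>Around a critical cycle the potential inequalities compose to an equality, because the
  normalized weight of the cycle is \<open>1\<close>; as all weights involved are finite, each
  single inequality is tight.\<close>

lemma critical_tight:
  assumes pot: "\<And>i j. normalized_mat A $ i $ j * Fin (x j) \<le> Fin (x i)"
    and e: "(i, j) \<in> arcs (critical_graph A)"
  shows "normalized_mat A $ i $ j * Fin (x j) = Fin (x i)"
proof -
  let ?N = "normalized_mat A"
  obtain p where p: "critical_cycle A p" "(i, j) \<in> set p"
    using e by (auto simp: critical_graph_def)
  let ?l = "length p"
  obtain w where w: "0 < ?l" "\<forall>k. w (k + ?l) = w k" "p = map (\<lambda>k. (w k, w (Suc k))) [0..<?l]"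
    "\<forall>k. A $ w k $ w (Suc k) \<noteq> 0"
    using cycle_fun[of A p] p(1) unfolding critical_cycle_def by blast
  have "(i, j) \<in> (\<lambda>k. (w k, w (Suc k))) ` {0..<?l}" using p(2) w(3) by (metis set_map set_upt)
  then obtain k where k: "k < ?l" "i = w k" "j = w (Suc k)" by auto
  have walk: "wwt ?N w a b * Fin (x (w b)) \<le> Fin (x (w a))" if "a \<le> b" for a b
    using that
  proof (induction b rule: dec_induct)
    case (step b)
    have "wwt ?N w a (Suc b) * Fin (x (w (Suc b))) \<le> wwt ?N w a b * Fin (x (w b))"
      using step pot[of "w b" "w (Suc b)"] by (simp add: wwt_Suc mult.assoc rmax_mult_mono)
    then show ?case using step.IH by (rule order_trans)
  qed simp
  have "critical_cycle A (map (\<lambda>k. (w k, w (Suc k))) [0..<?l])" using p w(3) by simp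
  then have "wwt ?N w 0 ?l = 1" by (rule critical_cycle_wwt[OF _ w(1,4)])
  moreover have "w ?l = w 0" using w(2) by (metis add_0)
  moreover have "wwt ?N w 0 ?l = wwt ?N w 0 k * (?N $ i $ j * wwt ?N w (Suc k) ?l)"
    using k wwt_split[of 0 k ?l ?N w] wwt_split[of k "Suc k" ?l ?N w] wwt_Suc[of k k ?N w]
    by simp
  ultimately have "Fin (x (w 0)) = wwt ?N w 0 k * (?N $ i $ j * (wwt ?N w (Suc k) ?l * Fin (x (w ?l))))"
    by (metis mult.assoc mult_1)
  also have "\<dots> \<le> wwt ?N w 0 k * (?N $ i $ j * Fin (x j))"
    using walk[of "Suc k" ?l] k by (intro rmax_mult_mono) auto
  finally have "wwt ?N w 0 k * Fin (x i) \<le> wwt ?N w 0 k * (?N $ i $ j * Fin (x j))"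
    using walk[of 0 k] k by auto
  then have "wwt ?N w 0 k * Fin (x i) = wwt ?N w 0 k * (?N $ i $ j * Fin (x j))"
    using rmax_mult_mono[OF order_refl pot] by (rule antisym)
  moreover have "wwt ?N w 0 k \<noteq> 0"
    using w(4) by (auto simp: wwt_neq_0_iff normalized_mat_def smult_mat_def)
  ultimately show ?thesis by (metis Fin_mult_cancel rmax_neq_0E)
qed

section \<open>A representing subgraph made of disjoint cycles\<close>

lemma critical_graph_simps [simp]:
  "tail (critical_graph A) = fst" "head (critical_graph A) = snd"
  by (simp_all add: critical_graph_def)

lemma wf_critical_graph: "wf_digraph (critical_graph A)"
  by unfold_locales (force simp: critical_graph_def)+

lemma critical_cycle_imp_cycle: "critical_cycle A p \<Longrightarrow> mat_cycle A p"
  by (simp add: critical_cycle_def)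

lemma critical_cycle_fun:
  assumes "critical_cycle A p"
  shows "\<exists>w. 0 < length p \<and> inj_on w {0..<length p} \<and> (\<forall>k. w (k + length p) = w k) \<and>
    set p = range (\<lambda>k. (w k, w (Suc k))) \<and> pre_digraph.cas (mat_digraph A) (w 0) p (w 0)"
proof -
  let ?l = "length p"
  obtain w where w: "0 < ?l" "inj_on w {0..<?l}" "\<forall>k. w (k + ?l) = w k"
    "p = map (\<lambda>k. (w k, w (Suc k))) [0..<?l]"
    using cycle_fun[OF critical_cycle_imp_cycle[OF assms]] by (elim exE conjE) (rule that; assumption)
  have eq: "w (k mod ?l) = w k" for k using periodic_fun_mod[of w ?l] w(3) by blast
  have "set p = (\<lambda>k. (w k, w (Suc k))) ` {0..<?l}" using w(4) by (metis set_map set_upt)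
  also have "\<dots> = range (\<lambda>k. (w k, w (Suc k)))"
  proof (intro equalityI subsetI)
    fix e assume "e \<in> range (\<lambda>k. (w k, w (Suc k)))"
    then obtain k where "e = (w k, w (Suc k))" by blast
    also have "\<dots> = (w (k mod ?l), w (Suc (k mod ?l)))"
      using eq[of k] eq[of "Suc k"] eq[of "Suc (k mod ?l)"] by (simp add: mod_Suc_eq)
    finally show "e \<in> (\<lambda>k. (w k, w (Suc k))) ` {0..<?l}" using w(1) by auto
  qed auto
  finally have "set p = range (\<lambda>k. (w k, w (Suc k)))" .
  moreover have "pre_digraph.cas (mat_digraph A) (w 0) p (w 0)"
    using cas_walk[of 0 ?l A w] w by (metis add_0 zero_le)
  ultimately show ?thesis using w(1-3) by (intro exI[of _ w]) simp
qed

lemma rtrancl_on_fun_path: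
  assumes "wf_digraph G" "tail G = fst" "head G = snd" "\<And>k. (w k, w (Suc k)) \<in> arcs G" "a \<le> b"
  shows "w a \<rightarrow>\<^sup>*\<^bsub>G\<^esub> w b"
  using assms(5)
proof (induction b rule: dec_induct)
  interpret wf_digraph G by fact
  case base
  have "w a \<in> verts G" using tail_in_verts[OF assms(4)[of a]] assms(2) by simp
  then show ?case by simp
next
  interpret wf_digraph G by fact
  case (step b)
  have "w b \<rightarrow>\<^bsub>G\<^esub> w (Suc b)" using assms by (force simp: arcs_ends_def arc_to_ends_def)
  with step.IH show ?case by (rule reachable_adj_trans)
qed

lemma critical_cycle_reachable:
  assumes "wf_digraph G" "tail G = fst" "head G = snd" "set p \<subseteq> arcs G" "critical_cycle A p"
    "u \<in> fst ` set p" "v \<in> fst ` set p"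
  shows "u \<rightarrow>\<^sup>*\<^bsub>G\<^esub> v"
proof -
  interpret wf_digraph G by fact
  obtain w where w: "0 < length p" "\<forall>k. w (k + length p) = w k"
    "set p = range (\<lambda>k. (w k, w (Suc k)))"
    using critical_cycle_fun[OF assms(5)] by (elim exE conjE) (rule that; assumption)
  obtain a b where ab: "u = w a" "v = w b" using assms(6,7) w(3) by auto
  \<comment> \<open>Adding \<open>a\<close> laps moves the target index beyond \<open>a\<close>,
    since \<open>length p\<close> is positive.\<close>
  have "w (b + a * length p) = w b"
    using periodic_fun_mod[of w "length p" "b + a * length p"] periodic_fun_mod[of w "length p" b] w(2) by auto
  moreover have "a \<le> a * length p" using w(1) by (cases "length p") auto
  then have "a \<le> b + a * length p" by linarith
  then have "w a \<rightarrow>\<^sup>*\<^bsub>G\<^esub> w (b + a * length p)"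
    using assms w(3) by (intro rtrancl_on_fun_path) auto
  ultimately show ?thesis using ab by simp
qed

text \<open>On a cycle every head is also the tail of the next arc, so tails suffice to describe the
  critical nodes.\<close>

lemma verts_critical_graph: "v \<in> verts (critical_graph A) \<longleftrightarrow> (\<exists>p. critical_cycle A p \<and> v \<in> fst ` set p)"
proof
  assume "v \<in> verts (critical_graph A)"
  then obtain p e where p: "critical_cycle A p" "e \<in> set p" "v = fst e \<or> v = snd e"
    by (auto simp: critical_graph_def)
  obtain w where "set p = range (\<lambda>k. (w k, w (Suc k)))" 
    using critical_cycle_fun[OF p(1)] by (elim exE conjE) (rule that; assumption)
  then have "v \<in> fst ` set p" using p(2,3) by (auto simp: image_image)
  then show "\<exists>p. critical_cycle A p \<and> v \<in> fst ` set p" using p by blast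
next
  assume "\<exists>p. critical_cycle A p \<and> v \<in> fst ` set p"
  then obtain p e where "critical_cycle A p" "e \<in> set p" "v = fst e" by blast
  then show "v \<in> verts (critical_graph A)"
    by (auto simp: critical_graph_def simp del: split_paired_Ex)
qed

definition scc_cycle :: "rmax^'n^'n \<Rightarrow> 'n set \<Rightarrow> ('n \<times> 'n) list" where
  "scc_cycle A S = (SOME p. critical_cycle A p \<and> fst ` set p \<subseteq> S)"

abbreviation crit_sccs :: "rmax^'n^'n \<Rightarrow> 'n set set" where
  "crit_sccs A \<equiv> pre_digraph.sccs_verts (critical_graph A)"

definition cycle_digraph :: "('n \<times> 'n) list \<Rightarrow> ('n, 'n \<times> 'n) pre_digraph" where
  "cycle_digraph p = \<lparr>verts = fst ` set p, arcs = set p, tail = fst, head = snd\<rparr>"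

definition cycles_graph :: "rmax^'n^'n \<Rightarrow> ('n, 'n \<times> 'n) pre_digraph" where
  "cycles_graph A = \<lparr>verts = (\<Union>S\<in>crit_sccs A. fst ` set (scc_cycle A S)),
     arcs = (\<Union>S\<in>crit_sccs A. set (scc_cycle A S)), tail = fst, head = snd\<rparr>"

text \<open>Every node of \<open>cycles_graph A\<close> has exactly one outgoing arc, so this choice
  is forced there and its iterates describe all walks of that graph.\<close>

definition succ_node :: "rmax^'n^'n \<Rightarrow> 'n \<Rightarrow> 'n" where
  "succ_node A u = (SOME v. (u, v) \<in> arcs (cycles_graph A))"

lemma cycles_graph_simps [simp]:
  "tail (cycles_graph A) = fst" "head (cycles_graph A) = snd"
  by (simp_all add: cycles_graph_def)

lemma cycle_digraph_simps [simp]: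
  "verts (cycle_digraph p) = fst ` set p" "arcs (cycle_digraph p) = set p"
  "tail (cycle_digraph p) = fst" "head (cycle_digraph p) = snd"
  by (simp_all add: cycle_digraph_def)

lemma finite_crit_sccs: "finite (crit_sccs (A :: rmax^'n^'n))"
  by (rule finite_subset[of _ UNIV]) auto

lemma crit_sccs_disjoint: "S \<in> crit_sccs A \<Longrightarrow> T \<in> crit_sccs A \<Longrightarrow> v \<in> S \<Longrightarrow> v \<in> T \<Longrightarrow> S = T"
  using wf_digraph.sccs_verts_disjoint[OF wf_critical_graph, of S A T] by blast

text \<open>The nodes of a critical cycle are mutually reachable in the critical graph, so a
  critical cycle through a node of \<open>S\<close> stays in \<open>S\<close>.\<close>

lemma scc_cycle:
  assumes S: "S \<in> crit_sccs A"
  shows "critical_cycle A (scc_cycle A S) \<and> fst ` set (scc_cycle A S) \<subseteq> S"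
  unfolding scc_cycle_def
proof (rule someI_ex)
  interpret wf_digraph "critical_graph A" by (rule wf_critical_graph)
  obtain v where v: "v \<in> S" using S by (auto simp: in_sccs_verts_conv_reachable)
  then have "v \<in> verts (critical_graph A)" using sccs_verts_subsets[OF S] by blast
  then obtain p where p: "critical_cycle A p" "v \<in> fst ` set p" by (auto simp: verts_critical_graph)
  have sub: "set p \<subseteq> arcs (critical_graph A)" using p(1) by (auto simp: critical_graph_def)
  have "u \<in> S" if u: "u \<in> fst ` set p" for u
  proof -
    have "v \<rightarrow>\<^sup>*\<^bsub>critical_graph A\<^esub> u" "u \<rightarrow>\<^sup>*\<^bsub>critical_graph A\<^esub> v"
      using critical_cycle_reachable[OF wf_critical_graph _ _ sub p(1)] u p(2) by simp_all
    then show ?thesis using S v unfolding in_sccs_verts_conv_reachable by blast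
  qed
  then show "\<exists>p. critical_cycle A p \<and> fst ` set p \<subseteq> S" using p by blast
qed

lemma cycles_graph_arcs_subset: "arcs (cycles_graph A) \<subseteq> arcs (critical_graph A)"
  using scc_cycle[of _ A] by (auto simp: cycles_graph_def critical_graph_def)

text \<open>One periodic enumeration of the chosen cycle, bundled with its compatibility with
  \<open>succ_node\<close>, so that later arguments obtain all these facts about the same
  \<open>w\<close>.\<close>

definition scc_enum :: "rmax^'n^'n \<Rightarrow> 'n set \<Rightarrow> (nat \<Rightarrow> 'n) \<Rightarrow> bool" where
  "scc_enum A S w \<longleftrightarrow> 0 < length (scc_cycle A S) \<and> inj_on w {0..<length (scc_cycle A S)} \<and>
    (\<forall>k. w (k + length (scc_cycle A S)) = w k) \<and>
    set (scc_cycle A S) = range (\<lambda>k. (w k, w (Suc k))) \<and>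
    pre_digraph.cas (mat_digraph A) (w 0) (scc_cycle A S) (w 0) \<and>
    (\<forall>k v. (w k, v) \<in> arcs (cycles_graph A) \<longleftrightarrow> v = w (Suc k)) \<and>
    (\<forall>k. succ_node A (w k) = w (Suc k)) \<and> (\<forall>k m. (succ_node A ^^ m) (w k) = w (k + m))"

lemma scc_enumD:
  assumes "scc_enum A S w"
  shows "0 < length (scc_cycle A S)" "inj_on w {0..<length (scc_cycle A S)}"
    "\<And>k. w (k + length (scc_cycle A S)) = w k" "set (scc_cycle A S) = range (\<lambda>k. (w k, w (Suc k)))"
    "pre_digraph.cas (mat_digraph A) (w 0) (scc_cycle A S) (w 0)"
    "\<And>k v. (w k, v) \<in> arcs (cycles_graph A) \<longleftrightarrow> v = w (Suc k)"
    "\<And>k. succ_node A (w k) = w (Suc k)" "\<And>k m. (succ_node A ^^ m) (w k) = w (k + m)"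
  using assms unfolding scc_enum_def by blast+

text \<open>An arc leaving \<open>w k\<close> comes from the chosen cycle of some component
  \<open>T\<close>. This shares the node \<open>w k\<close> with \<open>S\<close>, so
  \<open>T = S\<close>, and injectivity modulo the length determines the head.\<close>

lemma ex_scc_enum:
  assumes S: "S \<in> crit_sccs A"
  shows "\<exists>w. scc_enum A S w"
proof -
  let ?p = "scc_cycle A S" let ?l = "length ?p"
  obtain w where w: "0 < ?l" "inj_on w {0..<?l}" "\<forall>k. w (k + ?l) = w k"
    "set ?p = range (\<lambda>k. (w k, w (Suc k)))" "pre_digraph.cas (mat_digraph A) (w 0) ?p (w 0)"
    using critical_cycle_fun[OF conjunct1[OF scc_cycle[OF S]]] by (elim exE conjE) (rule that; assumption)
  have arc: "(w k, v) \<in> arcs (cycles_graph A) \<longleftrightarrow> v = w (Suc k)" for k v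
  proof
    assume "(w k, v) \<in> arcs (cycles_graph A)"
    then obtain T where T: "T \<in> crit_sccs A" "(w k, v) \<in> set (scc_cycle A T)"
      by (auto simp: cycles_graph_def)
    have "w k \<in> T" using scc_cycle[OF T(1)] T(2) by force
    moreover have "(w k, w (Suc k)) \<in> set ?p" using w(4) by simp
    then have "w k \<in> S" using scc_cycle[OF S] by force
    ultimately have "S = T" using crit_sccs_disjoint[OF S T(1)] by blast
    then obtain m where m: "w k = w m" "v = w (Suc m)" using T(2) w(4) by auto
    have iff: "w a = w b \<longleftrightarrow> a mod ?l = b mod ?l" for a b
      by (rule periodic_fun_eq_iff[OF _ w(2,1)]) (simp add: w(3))
    from m show "v = w (Suc k)" unfolding iff m(2) by (metis mod_Suc_eq)
  next
    assume "v = w (Suc k)"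
    then show "(w k, v) \<in> arcs (cycles_graph A)"
      using S w(4) by (auto simp: cycles_graph_def)
  qed
  have "succ_node A (w k) = w (Suc k)" for k by (simp add: succ_node_def arc)
  moreover from this have "(succ_node A ^^ m) (w k) = w (k + m)" for k m
    by (induction m) simp_all
  ultimately show ?thesis using w arc unfolding scc_enum_def by (intro exI[of _ w]) simp
qed

lemma scc_cycle_nonempty: "S \<in> crit_sccs A \<Longrightarrow> scc_cycle A S \<noteq> []"
  using ex_scc_enum[of S A] scc_enumD(1)[of A S] by auto

lemma cycles_graph_vertE:
  assumes "u \<in> verts (cycles_graph A)"
  obtains S where "S \<in> crit_sccs A" "u \<in> fst ` set (scc_cycle A S)"
  using assms by (auto simp: cycles_graph_def)

lemma cycles_graph_arc_iff:
  "(u, v) \<in> arcs (cycles_graph A) \<longleftrightarrow> u \<in> verts (cycles_graph A) \<and> v = succ_node A u"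
proof
  assume e: "(u, v) \<in> arcs (cycles_graph A)"
  then have u: "u \<in> verts (cycles_graph A)" by (force simp: cycles_graph_def)
  then obtain S where S: "S \<in> crit_sccs A" "u \<in> fst ` set (scc_cycle A S)" by (rule cycles_graph_vertE)
  obtain w where "scc_enum A S w" using ex_scc_enum[OF S(1)] by blast
  note w = scc_enumD(4,6,7)[OF this]
  then show "u \<in> verts (cycles_graph A) \<and> v = succ_node A u" using u e S(2) w by auto
next
  assume a: "u \<in> verts (cycles_graph A) \<and> v = succ_node A u"
  then obtain S where S: "S \<in> crit_sccs A" "u \<in> fst ` set (scc_cycle A S)" by (blast elim: cycles_graph_vertE)
  obtain w where "scc_enum A S w" using ex_scc_enum[OF S(1)] by blast
  note w = scc_enumD(4,6,7)[OF this]
  then show "(u, v) \<in> arcs (cycles_graph A)" using a S(2) w by auto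
qed

lemma scc_cycle_succ_closed:
  assumes S: "S \<in> crit_sccs A" "u \<in> fst ` set (scc_cycle A S)"
  shows "succ_node A u \<in> fst ` set (scc_cycle A S)"
proof -
  obtain w where "scc_enum A S w" using ex_scc_enum[OF S(1)] by blast
  note w = scc_enumD(4,7)[OF this]
  show ?thesis using S(2) w by (auto simp: image_image)
qed

lemma succ_node_closed: "u \<in> verts (cycles_graph A) \<Longrightarrow> succ_node A u \<in> verts (cycles_graph A)"
  using scc_cycle_succ_closed[of _ A u] unfolding cycles_graph_def by fastforce

lemma wf_cycles_graph: "wf_digraph (cycles_graph A)"
proof
  fix e assume e: "e \<in> arcs (cycles_graph A)"
  obtain u v where "e = (u, v)" by (cases e)
  then show "tail (cycles_graph A) e \<in> verts (cycles_graph A)"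
    "head (cycles_graph A) e \<in> verts (cycles_graph A)"
    using e cycles_graph_arc_iff[of u v A] succ_node_closed[of u A] by auto
qed

lemma scc_cycle_in_sccs_verts:
  assumes S: "S \<in> crit_sccs A"
  shows "fst ` set (scc_cycle A S) \<in> pre_digraph.sccs_verts (cycles_graph A)"
proof -
  interpret wf_digraph "cycles_graph A" by (rule wf_cycles_graph)
  let ?V = "fst ` set (scc_cycle A S)"
  have ne: "?V \<noteq> {}" using scc_cycle_nonempty[OF S] by simp
  have "u \<rightarrow>\<^sup>*\<^bsub>cycles_graph A\<^esub> v" if "u \<in> ?V" "v \<in> ?V" for u v
    using scc_cycle[OF S] S that
    by (intro critical_cycle_reachable[OF wf_cycles_graph]) (auto simp: cycles_graph_def)
  moreover have "v \<in> ?V" if "u \<rightarrow>\<^sup>*\<^bsub>cycles_graph A\<^esub> v" "u \<in> ?V" for u v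
    using that
  proof (induction rule: reachable_induct)
    case (step x y)
    then have "(x, y) \<in> arcs (cycles_graph A)" by (auto simp: arcs_ends_def arc_to_ends_def)
    then have "y = succ_node A x" using cycles_graph_arc_iff by blast
    then show ?case using scc_cycle_succ_closed[OF S] step by blast
  qed
  ultimately show ?thesis using ne unfolding in_sccs_verts_conv_reachable by blast
qed

lemma sccs_verts_cycles_graph:
  "pre_digraph.sccs_verts (cycles_graph A) = (\<lambda>S. fst ` set (scc_cycle A S)) ` crit_sccs A"
proof -
  interpret wf_digraph "cycles_graph A" by (rule wf_cycles_graph)
  have "T \<in> (\<lambda>S. fst ` set (scc_cycle A S)) ` crit_sccs A" if T: "T \<in> sccs_verts" for T
  proof -
    obtain u where u: "u \<in> T" using T by (auto simp: in_sccs_verts_conv_reachable)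
    then have "u \<in> verts (cycles_graph A)" using sccs_verts_subsets[OF T] by blast
    then obtain S where S: "S \<in> crit_sccs A" "u \<in> fst ` set (scc_cycle A S)" by (rule cycles_graph_vertE)
    then have "T = fst ` set (scc_cycle A S)"
      using sccs_verts_disjoint[OF T scc_cycle_in_sccs_verts[OF S(1)]] u by blast
    then show ?thesis using S by blast
  qed
  then show ?thesis using scc_cycle_in_sccs_verts by blast
qed

text \<open>There are no chords: an arc starting on the chosen cycle shares its tail with an arc of
  that cycle, and out-degree one makes the two arcs equal.\<close>

lemma induce_cycles_graph:
  assumes S: "S \<in> crit_sccs A"
  shows "induce_subgraph (cycles_graph A) (fst ` set (scc_cycle A S)) = cycle_digraph (scc_cycle A S)"
proof -
  let ?p = "scc_cycle A S"
  have "{e \<in> arcs (cycles_graph A). fst e \<in> fst ` set ?p \<and> snd e \<in> fst ` set ?p} = set ?p"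
  proof (intro equalityI subsetI)
    fix e assume "e \<in> {e \<in> arcs (cycles_graph A). fst e \<in> fst ` set ?p \<and> snd e \<in> fst ` set ?p}"
    then have e: "e \<in> arcs (cycles_graph A)" "fst e \<in> fst ` set ?p" by auto
    then obtain d where d: "d \<in> set ?p" "fst d = fst e" by auto
    then have "d \<in> arcs (cycles_graph A)" using S by (auto simp: cycles_graph_def)
    then have "snd d = snd e"
      using e(1) d(2) cycles_graph_arc_iff[of _ _ A] by (metis prod.collapse)
    then show "e \<in> set ?p" using d by (metis prod.expand)
  next
    fix e assume e: "e \<in> set ?p"
    then have "e \<in> arcs (cycles_graph A)" using S by (auto simp: cycles_graph_def)
    moreover have "snd e = succ_node A (fst e)"
      using calculation cycles_graph_arc_iff[of "fst e" "snd e" A] by simp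
    ultimately show "e \<in> {e \<in> arcs (cycles_graph A). fst e \<in> fst ` set ?p \<and> snd e \<in> fst ` set ?p}"
      using e scc_cycle_succ_closed[OF S, of "fst e"] by auto
  qed
  then show ?thesis
    by (simp add: induce_subgraph_def cycle_digraph_def)
qed

lemma sccs_cycles_graph:
  "pre_digraph.sccs (cycles_graph A) = (\<lambda>S. cycle_digraph (scc_cycle A S)) ` crit_sccs A"
  unfolding wf_digraph.sccs_conv_sccs_verts[OF wf_cycles_graph] sccs_verts_cycles_graph image_image
  by (rule image_cong) (simp_all add: induce_cycles_graph)

lemma wf_cycle_digraph: "S \<in> crit_sccs A \<Longrightarrow> wf_digraph (cycle_digraph (scc_cycle A S))"
proof
  fix e assume S: "S \<in> crit_sccs A" and e: "e \<in> arcs (cycle_digraph (scc_cycle A S))"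
  then have "e \<in> arcs (cycles_graph A)" by (auto simp: cycles_graph_def)
  then have "snd e = succ_node A (fst e)" using cycles_graph_arc_iff[of "fst e" "snd e" A] by simp
  then show "tail (cycle_digraph (scc_cycle A S)) e \<in> verts (cycle_digraph (scc_cycle A S))"
    "head (cycle_digraph (scc_cycle A S)) e \<in> verts (cycle_digraph (scc_cycle A S))"
    using e scc_cycle_succ_closed[OF S, of "fst e"] by auto
qed

text \<open>The cycle itself is a closed walk. Conversely, any closed walk follows
  \<open>succ_node\<close>, so its length \<open>m\<close> satisfies \<open>w k = w (k + m)\<close>
  and is a multiple of the length of the cycle.\<close>

lemma scc_cyclicity_cycle:
  assumes S: "S \<in> crit_sccs A"
  shows "scc_cyclicity (cycle_digraph (scc_cycle A S)) = length (scc_cycle A S)"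
proof -
  let ?p = "scc_cycle A S" let ?C = "cycle_digraph ?p"
  interpret wf_digraph ?C by (rule wf_cycle_digraph[OF S])
  obtain w where "scc_enum A S w" using ex_scc_enum[OF S(1)] by blast
  note w = scc_enumD(1-5,8)[OF this]
  have "compatible (mat_digraph A) ?C" by (simp add: compatible_def)
  then have "cas (w 0) ?p (w 0)" using w(5) compatible_cas by metis
  then have "awalk (w 0) ?p (w 0)" using w(4) by (auto simp: awalk_def image_image)
  then have "Gcd {length q | q u. awalk u q u} dvd length ?p" by (intro Gcd_dvd) blast
  moreover have "length ?p dvd Gcd {length q | q u. awalk u q u}"
  proof (rule Gcd_greatest)
    fix m assume "m \<in> {length q | q u. awalk u q u}"
    then obtain q u where q: "m = length q" "awalk u q u" by blast
    have step: "v = (succ_node A ^^ length q) u" if "cas u q v" "set q \<subseteq> set ?p" for u q v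
      using that
    proof (induction q arbitrary: u)
      case (Cons e q)
      then have "e \<in> arcs (cycles_graph A)" using S by (auto simp: cycles_graph_def)
      then have "snd e = succ_node A (fst e)" using cycles_graph_arc_iff[of "fst e" "snd e" A] by simp
      then show ?case using Cons.prems Cons.IH[of "succ_node A u"] by (auto simp: funpow_swap1)
    qed simp
    have "u = (succ_node A ^^ m) u" using step[of u q u] q by (auto simp: awalk_def)
    moreover obtain k where "u = w k" using q(2) w(4) by (auto simp: awalk_def)
    ultimately have "w k = w (k + m)" using w(6) by metis
    then have "k mod length ?p = (k + m) mod length ?p"
      using periodic_fun_eq_iff[of w "length ?p" k "k + m", OF w(3,2,1)] by simp
    then show "length ?p dvd m" using mod_diff_eq_0[of k "k + m" "length ?p"] by simp
  qed
  ultimately show ?thesis unfolding scc_cyclicity_def by (rule dvd_antisym)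
qed

lemma cyclicity_cycles_graph:
  "cyclicity (cycles_graph A) = Lcm ((\<lambda>S. length (scc_cycle A S)) ` crit_sccs A)"
  unfolding cyclicity_def sccs_cycles_graph image_image
  by (intro arg_cong[of _ _ Lcm] image_cong) (simp_all add: scc_cyclicity_cycle)

lemma cyclicity_pos: "0 < cyclicity (cycles_graph A)"
  using scc_cycle_nonempty[of _ A] finite_crit_sccs[of A]
  by (force simp: cyclicity_cycles_graph Lcm_0_iff intro!: Nat.gr0I)

lemma cycles_graph_subgraph: "subgraph (cycles_graph A) (critical_graph A)"
proof (rule subgraphI)
  show "verts (cycles_graph A) \<subseteq> verts (critical_graph A)"
  proof
    fix v assume "v \<in> verts (cycles_graph A)"
    then obtain S where "S \<in> crit_sccs A" "v \<in> fst ` set (scc_cycle A S)" by (rule cycles_graph_vertE)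
    then show "v \<in> verts (critical_graph A)"
      unfolding verts_critical_graph using scc_cycle by blast
  qed
qed (simp_all add: cycles_graph_arcs_subset compatible_def wf_critical_graph wf_cycles_graph)

text \<open>Arcs cannot leave a chosen cycle, as it is closed under \<open>succ_node\<close>. A
  component of the critical graph contains its own chosen cycle; containing that of \<open>T\<close>
  as well would make it meet, hence equal, \<open>T\<close>.\<close>

lemma representing_cycles_graph: "representing_subgraph (cycles_graph A) (critical_graph A)"
  unfolding representing_subgraph_def
proof (intro conjI ballI impI)
  show "subgraph (cycles_graph A) (critical_graph A)" by (rule cycles_graph_subgraph)
next
  interpret wf_digraph "cycles_graph A" by (rule wf_cycles_graph)
  fix L L' assume L: "L \<in> sccs" "L' \<in> sccs" "L \<noteq> L'"
  then obtain S where S: "S \<in> crit_sccs A" "L = cycle_digraph (scc_cycle A S)"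
    unfolding sccs_cycles_graph by blast
  have closed: "snd e \<in> verts L" if "e \<in> arcs (cycles_graph A)" "fst e \<in> verts L" for e
    using that S scc_cycle_succ_closed[OF S(1), of "fst e"] cycles_graph_arc_iff[of "fst e" "snd e" A] by simp
  show "\<not> (\<exists>e\<in>arcs (cycles_graph A). tail (cycles_graph A) e \<in> verts L \<and> head (cycles_graph A) e \<in> verts L')"
  proof (intro notI, elim bexE conjE)
    fix e assume e: "e \<in> arcs (cycles_graph A)" "tail (cycles_graph A) e \<in> verts L"
      "head (cycles_graph A) e \<in> verts L'"
    then have "snd e \<in> verts L \<inter> verts L'" using closed[of e] by simp
    then show False using scc_disj[OF L] by blast
  qed
next
  interpret H: wf_digraph "critical_graph A" by (rule wf_critical_graph)
  fix K assume K: "K \<in> H.sccs"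
  define S where "S = verts K"
  have S: "S \<in> crit_sccs A" unfolding H.sccs_verts_conv S_def using K by (rule imageI)
  let ?L = "cycle_digraph (scc_cycle A S)"
  have ind: "induced_subgraph K (critical_graph A)" using K by (rule H.in_sccs_imp_induced)
  have comp: "tail K = fst" "head K = snd" and wfK: "wf_digraph K"
    using ind unfolding induced_subgraph_def subgraph_def compatible_def by simp_all
  have arcsK: "arcs K = {e \<in> arcs (critical_graph A). fst e \<in> S \<and> snd e \<in> S}"
    using ind unfolding induced_subgraph_def S_def by simp
  have sub: "subgraph ?L K"
  proof (rule subgraphI)
    show V: "verts ?L \<subseteq> verts K" using scc_cycle[OF S] by (simp add: S_def)
    show "arcs ?L \<subseteq> arcs K"
    proof
      fix e assume e: "e \<in> arcs ?L"
      then have "fst e \<in> verts ?L" "snd e \<in> verts ?L"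
        using wf_digraph.wellformed[OF wf_cycle_digraph[OF S] e] by simp_all
      then have "fst e \<in> S" "snd e \<in> S" using scc_cycle[OF S] by auto
      moreover have "e \<in> arcs (critical_graph A)"
        using e scc_cycle[OF S] unfolding critical_graph_def by auto
      ultimately show "e \<in> arcs K" unfolding arcsK by simp
    qed
  qed (simp_all add: compatible_def comp wfK wf_cycle_digraph[OF S])
  show "\<exists>!L. L \<in> pre_digraph.sccs (cycles_graph A) \<and> subgraph L K"
  proof (rule ex1I[of _ ?L])
    show "?L \<in> pre_digraph.sccs (cycles_graph A) \<and> subgraph ?L K"
      using S sub unfolding sccs_cycles_graph by blast
  next
    fix L assume L: "L \<in> pre_digraph.sccs (cycles_graph A) \<and> subgraph L K"
    then obtain T where T: "T \<in> crit_sccs A" "L = cycle_digraph (scc_cycle A T)"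
      unfolding sccs_cycles_graph by blast
    have "fst ` set (scc_cycle A T) \<subseteq> S" using L T unfolding subgraph_def S_def by simp
    moreover have e: "hd (scc_cycle A T) \<in> set (scc_cycle A T)" using scc_cycle_nonempty[OF T(1)] by simp
    moreover have "fst ` set (scc_cycle A T) \<subseteq> T" using scc_cycle[OF T(1)] by simp
    ultimately have "fst (hd (scc_cycle A T)) \<in> S" "fst (hd (scc_cycle A T)) \<in> T" by (meson image_eqI subsetD)+
    then have "S = T" by (rule crit_sccs_disjoint[OF S T(1)])
    then show "L = ?L" using T by simp
  qed
qed

lemma no_trivial_cycles_graph: "no_trivial_scc (cycles_graph A)"
  unfolding no_trivial_scc_def sccs_cycles_graph using scc_cycle_nonempty by auto

section \<open>Powers of a matrix carried by a function\<close>

text \<open>The rows in \<open>V\<close> have one finite entry each, so a power follows the orbit of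
  \<open>f\<close> and the potential differences telescope. Taking \<open>x\<close> to be the
  critical potential gives \<open>csr_S\<close>, taking it constantly zero gives its Boolean
  counterpart.\<close>

lemma functional_mat_power:
  fixes S :: "rmax^'n^'n" and x :: "'n \<Rightarrow> real"
  assumes S: "\<And>i j. S $ i $ j = (if i \<in> V \<and> j = f i then Fin (x i - x (f i)) else 0)"
    and closed: "\<And>i. i \<in> V \<Longrightarrow> f i \<in> V" and u: "u \<in> V"
  shows "mpow S t $ u $ v = (if v = (f ^^ t) u then Fin (x u - x ((f ^^ t) u)) else 0)"
  using u
proof (induction t arbitrary: u)
  case 0
  then show ?case by (simp add: mat_def one_rmax_def)
next
  case (Suc t)
  have "mpow S (Suc t) $ u $ v = (\<Sum>k\<in>UNIV. S $ u $ k * mpow S t $ k $ v)"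
    by (simp add: matrix_matrix_mult_def)
  also have "\<dots> = (\<Sum>k\<in>UNIV. if k = f u then S $ u $ f u * mpow S t $ f u $ v else 0)"
    by (intro sum.cong) (auto simp: S Suc.prems)
  also have "\<dots> = S $ u $ f u * mpow S t $ f u $ v" by simp
  finally show ?case using Suc.IH[OF closed[OF Suc.prems]] Suc.prems
    by (simp add: S funpow_swap1)
qed

text \<open>Positive exponents only: the zeroth power has diagonal entry \<open>1\<close> outside
  \<open>V\<close> too.\<close>

lemma functional_mat_power_outside:
  fixes S :: "rmax^'n^'n"
  assumes S: "\<And>i j. i \<notin> V \<Longrightarrow> S $ i $ j = 0" and u: "u \<notin> V"
  shows "mpow S (Suc t) $ u $ v = 0"
  using S[OF u] by (simp add: matrix_matrix_mult_def)

definition pot :: "rmax^'n^'n \<Rightarrow> 'n \<Rightarrow> real" where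
  "pot A = (SOME x. \<forall>i j. normalized_mat A $ i $ j * Fin (x j) \<le> Fin (x i))"

section \<open>CSR terms of the disjoint critical cycles\<close>

context
  fixes A :: "rmax^'n^'n"
begin

interpretation N: definite "normalized_mat A"
  by unfold_locales (rule normalized_definite)

private abbreviation (input) "\<N> \<equiv> normalized_mat A"
private abbreviation (input) "\<G> \<equiv> cycles_graph A"
private abbreviation (input) "f \<equiv> succ_node A"
private abbreviation (input) "\<gamma> \<equiv> cyclicity (cycles_graph A)"

lemma pot: "\<N> $ i $ j * Fin (pot A j) \<le> Fin (pot A i)"
  using someI_ex[OF N.ex_potential] unfolding pot_def by blast

lemma normalized_arc:
  assumes "(u, v) \<in> arcs (critical_graph A)"
  shows "\<N> $ u $ v = Fin (pot A u - pot A v)"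
  using critical_tight[of A "pot A", OF pot assms]
  by (cases "\<N> $ u $ v") (auto simp: zero_rmax_def)

lemma normalized_succ:
  assumes "u \<in> verts \<G>" shows "\<N> $ u $ f u = Fin (pot A u - pot A (f u))"
  using assms cycles_graph_arc_iff[of u "f u" A] cycles_graph_arcs_subset[of A]
  by (intro normalized_arc) blast

lemma succ_funpow_closed: "u \<in> verts \<G> \<Longrightarrow> (f ^^ t) u \<in> verts \<G>"
  by (induction t) (simp_all add: succ_node_closed)

lemma csr_S_entry:
  "csr_S A \<G> $ i $ j = (if i \<in> verts \<G> \<and> j = f i then Fin (pot A i - pot A (f i)) else 0)"
  by (simp add: csr_S_def cycles_graph_arc_iff normalized_succ)

lemma csr_S_power:
  "u \<in> verts \<G> \<Longrightarrow> mpow (csr_S A \<G>) t $ u $ v =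
    (if v = (f ^^ t) u then Fin (pot A u - pot A ((f ^^ t) u)) else 0)"
  by (rule functional_mat_power[where V = "verts \<G>"]) (simp_all add: csr_S_entry succ_node_closed)

lemma wwt_succ:
  assumes "u \<in> verts \<G>"
  shows "wwt \<N> (\<lambda>k. (f ^^ k) u) 0 t = Fin (pot A u - pot A ((f ^^ t) u))"
  by (induction t) (simp_all add: wwt_Suc one_rmax_def normalized_succ succ_funpow_closed assms)

lemma mpow_succ_ge:
  assumes "u \<in> verts \<G>"
  shows "Fin (pot A u - pot A ((f ^^ t) u)) \<le> mpow \<N> t $ u $ (f ^^ t) u"
  using wwt_le_mpow[of 0 t \<N> "\<lambda>k. (f ^^ k) u"] wwt_succ[OF assms, of t] by simp

lemma scc_cycle_orbit:
  assumes S: "S \<in> crit_sccs A" and u: "u \<in> fst ` set (scc_cycle A S)"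
  shows "(f ^^ length (scc_cycle A S)) u = u"
    and "(\<lambda>m. (f ^^ m) u) ` {0..<length (scc_cycle A S)} = fst ` set (scc_cycle A S)"
    and "card (fst ` set (scc_cycle A S)) = length (scc_cycle A S)"
proof -
  let ?l = "length (scc_cycle A S)"
  obtain w where "scc_enum A S w" using ex_scc_enum[OF S] by blast
  note w = scc_enumD(1-4,8)[OF this]
  obtain k where k: "u = w k" using u w(4) by auto
  show "(f ^^ ?l) u = u" using w(3,5) k by simp
  have Z: "fst ` set (scc_cycle A S) = range w" by (simp add: w(4) image_image)
  have "range w = w ` {0..<?l}"
    using periodic_fun_mod[of w ?l, OF w(3)] w(1) by (force intro: image_eqI[of _ _ "_ mod ?l"])
  then show card: "card (fst ` set (scc_cycle A S)) = ?l"
    using w(2) Z by (simp add: card_image)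
  have mod_cancel: "a mod m = b mod m" if "(k + a) mod m = (k + b) mod m" for a b m
    using that by (cases a b rule: le_cases) (metis add_le_cancel_left diff_cancel2 add.commute mod_diff_eq_0 mod_eq_dvd_iff_nat)+
  have "inj_on (\<lambda>m. w (k + m)) {0..<?l}"
  proof (rule inj_onI)
    fix a b assume ab: "a \<in> {0..<?l}" "b \<in> {0..<?l}" "w (k + a) = w (k + b)"
    then have "(k + a) mod ?l = (k + b) mod ?l"
      using periodic_fun_eq_iff[of w ?l, OF w(3,2,1)] by blast
    then have "a mod ?l = b mod ?l" by (rule mod_cancel)
    then show "a = b" using ab by simp
  qed
  then have "card ((\<lambda>m. w (k + m)) ` {0..<?l}) = card (range w)"
    using card Z by (simp add: card_image)
  then have "(\<lambda>m. w (k + m)) ` {0..<?l} = range w"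
    by (intro card_subset_eq) auto
  then show "(\<lambda>m. (f ^^ m) u) ` {0..<?l} = fst ` set (scc_cycle A S)"
    using Z k w(5) by simp
qed

lemma scc_cycle_length_dvd: "S \<in> crit_sccs A \<Longrightarrow> length (scc_cycle A S) dvd \<gamma>"
  unfolding cyclicity_cycles_graph by (intro dvd_Lcm) blast

lemma scc_cycle_length_le_cr: "S \<in> crit_sccs A \<Longrightarrow> length (scc_cycle A S) \<le> cr (mat_digraph A)"
  using scc_cycle critical_cycle_imp_cycle cycle_length_le_cr by blast

lemma succ_funpow_mult:
  assumes S: "S \<in> crit_sccs A" "u \<in> fst ` set (scc_cycle A S)" and "length (scc_cycle A S) dvd m"
  shows "(f ^^ m) u = u"
proof -
  obtain q where q: "m = length (scc_cycle A S) * q" using assms(3) by blast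
  have "((f ^^ length (scc_cycle A S)) ^^ q) u = u"
    using scc_cycle_orbit(1)[OF S] by (induction q) simp_all
  then show ?thesis by (simp add: q funpow_mult)
qed

lemma succ_funpow_cyclicity: "u \<in> verts \<G> \<Longrightarrow> (f ^^ \<gamma>) u = u"
  using succ_funpow_mult scc_cycle_length_dvd by (blast elim: cycles_graph_vertE)

text \<open>Scaling by the potential turns every finite entry of \<open>csr_S\<close> into
  \<open>1\<close>. The \<gamma>-th iterate of the successor map fixes every node of the cycles, and
  the remaining rows vanish in all positive powers.\<close>

lemma csr_S_similar_periodic:
  "\<exists>P. boolean_mat P \<and> periodic_mat P \<and> diag_similar (csr_S A \<G>) P"
proof -
  define P :: "rmax^'n^'n" where "P = (\<chi> i j. if i \<in> verts \<G> \<and> j = f i then 1 else 0)"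
  \<comment> \<open>\<open>Fin (0 - 0)\<close> brings \<open>P\<close> into the form of
    \<open>functional_mat_power\<close> with zero potential.\<close>
  have P: "P $ i $ j = (if i \<in> verts \<G> \<and> j = f i then Fin (0 - 0) else 0)" for i j
    by (simp add: P_def one_rmax_def)
  have "boolean_mat P" by (simp add: boolean_mat_def P_def)
  moreover have "diag_similar (csr_S A \<G>) P"
    unfolding diag_similar_def csr_S_entry
    by (rule exI[of _ "pot A"]) (simp add: P)
  moreover have "mpow P (t + \<gamma>) = mpow P t" if t: "t \<ge> 1" for t
  proof -
    have "mpow P (t + \<gamma>) $ u $ v = mpow P t $ u $ v" for u v
    proof (cases "u \<in> verts \<G>")
      case True
      have "(f ^^ (t + \<gamma>)) u = (f ^^ t) u"
        using succ_funpow_cyclicity[OF True] by (simp add: funpow_add)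
      then show ?thesis
        using functional_mat_power[of P "verts \<G>" f "\<lambda>_. 0", OF P succ_node_closed True] by simp
    next
      case False
      obtain s where "t = Suc s" using t by (cases t) auto
      then show ?thesis
        using functional_mat_power_outside[of "verts \<G>" P u, OF _ False] by (simp add: P)
    qed
    then show ?thesis by (simp add: vec_eq_iff)
  qed
  then have "periodic_mat P" unfolding periodic_mat_def using cyclicity_pos by blast
  ultimately show ?thesis by blast
qed

lemma critical_path_ge:
  assumes "u \<rightarrow>\<^sup>*\<^bsub>critical_graph A\<^esub> v"
  shows "\<exists>k. Fin (pot A u - pot A v) \<le> mpow \<N> k $ u $ v"
proof -
  interpret H: wf_digraph "critical_graph A" by (rule wf_critical_graph)
  show ?thesis using assms
  proof (induction rule: H.reachable_induct)
    case base
    show ?case by (rule exI[of _ 0]) (simp add: mat_def one_rmax_def)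
  next
    case (step y z)
    then obtain k where k: "Fin (pot A u - pot A y) \<le> mpow \<N> k $ u $ y" by blast
    have "(y, z) \<in> arcs (critical_graph A)" using step by (auto simp: arcs_ends_def arc_to_ends_def)
    then have yz: "\<N> $ y $ z = Fin (pot A y - pot A z)" by (rule normalized_arc)
    have "Fin (pot A u - pot A z) = Fin (pot A u - pot A y) * \<N> $ y $ z" by (simp add: yz)
    also have "\<dots> \<le> mpow \<N> k $ u $ y * mpow \<N> 1 $ y $ z"
      using k by (simp add: rmax_mult_mono)
    also have "\<dots> \<le> mpow \<N> (k + 1) $ u $ z" by (rule mpow_ge)
    finally show ?case by blast
  qed
qed

text \<open>Critical paths join \<open>v\<close> to the chosen cycle of its component in both
  directions, and along them the weights are at least the potential differences, by
  tightness.\<close>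

lemma critical_detour:
  assumes v: "v \<in> verts (critical_graph A)"
  obtains S u a b where "S \<in> crit_sccs A" "u \<in> fst ` set (scc_cycle A S)" "\<gamma> dvd a + b"
    "Fin (pot A v - pot A u) \<le> mpow \<N> a $ v $ u" "Fin (pot A u - pot A v) \<le> mpow \<N> b $ u $ v"
proof -
  interpret H: wf_digraph "critical_graph A" by (rule wf_critical_graph)
  define S where "S = H.scc_of v"
  have S: "S \<in> crit_sccs A" using v unfolding S_def by (rule H.scc_of_in_sccs_verts)
  define u where "u = fst (hd (scc_cycle A S))"
  have u: "u \<in> fst ` set (scc_cycle A S)"
    using scc_cycle_nonempty[OF S] by (simp add: u_def)
  then have "u \<in> S" using scc_cycle[OF S] by blast
  then have "v \<rightarrow>\<^sup>*\<^bsub>critical_graph A\<^esub> u" "u \<rightarrow>\<^sup>*\<^bsub>critical_graph A\<^esub> v"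
    by (auto simp: S_def H.scc_of_def)
  then obtain a b where a: "Fin (pot A v - pot A u) \<le> mpow \<N> a $ v $ u"
    and b: "Fin (pot A u - pot A v) \<le> mpow \<N> b $ u $ v"
    using critical_path_ge by meson
  have "1 = Fin (pot A u - pot A v) * Fin (pot A v - pot A u)" by (simp add: one_rmax_def)
  also have "\<dots> \<le> mpow \<N> b $ u $ v * mpow \<N> a $ v $ u" using a b by (intro rmax_mult_mono)
  also have "\<dots> \<le> mpow \<N> (b + a) $ u $ u" by (rule mpow_ge)
  \<comment> \<open>Before returning, the closed walk of length \<open>b + a\<close> at
    \<open>u\<close> is repeated \<open>\<gamma> - 1\<close> times; with the detour itself this
    makes the total length \<open>\<gamma> * (a + b)\<close>.\<close>
  finally have "1 \<le> mpow \<N> ((b + a) * (\<gamma> - 1)) $ u $ u" by (rule N.mpow_closed_ge_1)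
  then have "1 * Fin (pot A u - pot A v) \<le> mpow \<N> ((b + a) * (\<gamma> - 1)) $ u $ u * mpow \<N> b $ u $ v"
    using b by (intro rmax_mult_mono)
  also have "\<dots> \<le> mpow \<N> ((b + a) * (\<gamma> - 1) + b) $ u $ v" by (rule mpow_ge)
  finally have "Fin (pot A u - pot A v) \<le> mpow \<N> ((b + a) * (\<gamma> - 1) + b) $ u $ v" by simp
  moreover have "a + ((b + a) * (\<gamma> - 1) + b) = (b + a) * \<gamma>"
    using cyclicity_pos[of A] by (cases \<gamma>) (auto simp: algebra_simps)
  then have "\<gamma> dvd a + ((b + a) * (\<gamma> - 1) + b)" by simp
  ultimately show thesis using that S u a by blast
qed

text \<open>Modulo \<gamma>, walks can be shortened without loss of weight, so finitely many
  exponents dominate all others. The supremum in the Kleene star is therefore over a bounded set and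
  is a maximum.\<close>

lemma csr_M_attained: "\<exists>k. csr_M A \<G> $ i $ j = mpow \<N> (\<gamma> * k) $ i $ j"
  and csr_M_ge: "mpow \<N> (\<gamma> * k) $ i $ j \<le> csr_M A \<G> $ i $ j"
proof -
  define F where "F = (\<lambda>k. mpow \<N> (\<gamma> * k) $ i $ j) ` {..<CARD('n)}"
  have bound: "\<exists>y\<in>F. mpow \<N> (\<gamma> * k) $ i $ j \<le> y" for k
  proof -
    obtain L where L: "L < CARD('n) * \<gamma>" "L mod \<gamma> = (\<gamma> * k) mod \<gamma>" "mpow \<N> (\<gamma> * k) $ i $ j \<le> mpow \<N> L $ i $ j"
      using N.mpow_reduce[OF cyclicity_pos[of A], of "\<gamma> * k" i j] by blast
    then obtain q where q: "L = \<gamma> * q" by auto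
    then have "q < CARD('n)" using L(1) by (simp add: mult.commute)
    then show ?thesis using L(3) q by (auto simp: F_def)
  qed
  have fin: "finite F" "F \<noteq> {}" by (auto simp: F_def lessThan_empty_iff)
  have eq: "csr_M A \<G> $ i $ j = (SUP k. mpow \<N> (\<gamma> * k) $ i $ j)"
    by (simp add: csr_M_def kleene_star_def mpow_mult)
  have le: "mpow \<N> (\<gamma> * k) $ i $ j \<le> Max F" for k
    using bound[of k] fin by (meson Max_ge order_trans)
  then have bdd: "bdd_above (range (\<lambda>k. mpow \<N> (\<gamma> * k) $ i $ j))" by (intro bdd_aboveI[of _ "Max F"]) auto
  show "mpow \<N> (\<gamma> * k) $ i $ j \<le> csr_M A \<G> $ i $ j"
    unfolding eq by (rule cSUP_upper[OF _ bdd]) simp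
  obtain k where k: "Max F = mpow \<N> (\<gamma> * k) $ i $ j" using Max_in[OF fin] by (auto simp: F_def)
  have "(SUP k. mpow \<N> (\<gamma> * k) $ i $ j) = mpow \<N> (\<gamma> * k) $ i $ j"
  proof (rule antisym)
    show "(SUP k. mpow \<N> (\<gamma> * k) $ i $ j) \<le> mpow \<N> (\<gamma> * k) $ i $ j"
      using le k by (intro cSUP_least) auto
    show "mpow \<N> (\<gamma> * k) $ i $ j \<le> (SUP k. mpow \<N> (\<gamma> * k) $ i $ j)"
      by (rule cSUP_upper[OF _ bdd]) simp
  qed
  then show "\<exists>k. csr_M A \<G> $ i $ j = mpow \<N> (\<gamma> * k) $ i $ j" unfolding eq by blast
qed

private abbreviation (input) "csr t \<equiv> csr_C A \<G> ** mpow (csr_S A \<G>) t ** csr_R A \<G>"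

text \<open>
  A walk through a critical node \<open>v\<close> is lengthened by the detour to a chosen cycle; waiting on that
  cycle makes the two outer parts of length divisible by the cyclicity.
\<close>

lemma csr_ge:
  assumes v: "v \<in> verts (critical_graph A)" and t: "t = r + s"
  shows "mpow \<N> r $ i $ v * mpow \<N> s $ v $ j \<le> csr t $ i $ j"
proof -
  obtain S u a b where S: "S \<in> crit_sccs A" "u \<in> fst ` set (scc_cycle A S)" and ab: "\<gamma> dvd a + b"
    "Fin (pot A v - pot A u) \<le> mpow \<N> a $ v $ u" "Fin (pot A u - pot A v) \<le> mpow \<N> b $ u $ v"
    using critical_detour[OF v] by metis
  have uG: "u \<in> verts \<G>" using S by (auto simp: cycles_graph_def)
  have g: "\<gamma> > 0" by (rule cyclicity_pos)
  define c where "c = (\<gamma> - 1) * (r + a)"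
  define d where "d = (\<gamma> - 1) * (b + s)"
  have wait: "k + (\<gamma> - 1) * k = \<gamma> * k" for k
    using g by (cases \<gamma>) simp_all
  have c: "r + a + c = \<gamma> * (r + a)" and d: "d + b + s = \<gamma> * (b + s)"
    using wait[of "r + a"] wait[of "b + s"] by (simp_all only: c_def d_def add_ac)
  define p where "p = (f ^^ c) u"
  define q where "q = (f ^^ t) p"
  have pG: "p \<in> verts \<G>" and qG: "q \<in> verts \<G>"
    using uG succ_funpow_closed unfolding p_def q_def by blast+
  \<comment> \<open>Of the lengthened walk, \<open>c + t + d\<close> steps run along the chosen
    cycle from \<open>u\<close> and have to end at \<open>u\<close> again. Adding
    \<open>a + b\<close>, itself a multiple of \<gamma>, gives the total length of both outer parts,
    since \<open>t = r + s\<close>.\<close>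
  have "\<gamma> dvd c + t + d"
  proof -
    have "(c + t + d) + (a + b) = \<gamma> * (r + a) + \<gamma> * (b + s)"
      using c d t by linarith
    then have "\<gamma> dvd (c + t + d) + (a + b)" by simp
    then show ?thesis using ab(1) by (simp only: dvd_add_left_iff)
  qed
  then have "length (scc_cycle A S) dvd c + t + d"
    by (rule dvd_trans[OF scc_cycle_length_dvd[OF S(1)]])
  then have "length (scc_cycle A S) dvd d + t + c" by (simp add: add_ac)
  then have fu: "(f ^^ d) q = u"
    using succ_funpow_mult[OF S, of "d + t + c"] unfolding p_def q_def by (simp add: funpow_add)
  have 1: "mpow \<N> r $ i $ v * (Fin (pot A v - pot A u) * Fin (pot A u - pot A p)) \<le> csr_C A \<G> $ i $ p"
  proof -
    have "mpow \<N> r $ i $ v * (Fin (pot A v - pot A u) * Fin (pot A u - pot A p))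
        \<le> mpow \<N> r $ i $ v * (mpow \<N> a $ v $ u * mpow \<N> c $ u $ p)"
      using ab(2) mpow_succ_ge[OF uG, of c] by (intro rmax_mult_mono) (auto simp: p_def)
    also have "\<dots> \<le> mpow \<N> r $ i $ v * mpow \<N> (a + c) $ v $ p"
      by (intro rmax_mult_mono mpow_ge) simp
    also have "\<dots> \<le> mpow \<N> (r + (a + c)) $ i $ p" by (rule mpow_ge)
    also have "\<dots> = mpow \<N> (\<gamma> * (r + a)) $ i $ p" using c by (simp add: add.assoc)
    also have "\<dots> \<le> csr_M A \<G> $ i $ p" by (rule csr_M_ge)
    finally show ?thesis using pG by (simp add: csr_C_def)
  qed
  have 2: "Fin (pot A q - pot A u) * Fin (pot A u - pot A v) * mpow \<N> s $ v $ j \<le> csr_R A \<G> $ q $ j"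
  proof -
    have "Fin (pot A q - pot A u) * Fin (pot A u - pot A v) * mpow \<N> s $ v $ j
        \<le> mpow \<N> d $ q $ u * mpow \<N> b $ u $ v * mpow \<N> s $ v $ j"
      using ab(3) mpow_succ_ge[OF qG, of d] by (intro rmax_mult_mono) (auto simp: fu)
    also have "\<dots> \<le> mpow \<N> (d + b) $ q $ v * mpow \<N> s $ v $ j"
      by (intro rmax_mult_mono mpow_ge) simp
    also have "\<dots> \<le> mpow \<N> (d + b + s) $ q $ j" by (rule mpow_ge)
    also have "\<dots> = mpow \<N> (\<gamma> * (b + s)) $ q $ j" using d by simp
    also have "\<dots> \<le> csr_M A \<G> $ q $ j" by (rule csr_M_ge)
    finally show ?thesis using qG by (simp add: csr_R_def)
  qed
  \<comment> \<open>The inserted potential differences along \<open>v\<close>, \<open>u\<close>,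
    \<open>p\<close>, \<open>q\<close>, \<open>u\<close>, \<open>v\<close> telescope to
    zero.\<close>
  have "mpow \<N> r $ i $ v * mpow \<N> s $ v $ j =
    (mpow \<N> r $ i $ v * (Fin (pot A v - pot A u) * Fin (pot A u - pot A p))) *
    Fin (pot A p - pot A q) * (Fin (pot A q - pot A u) * Fin (pot A u - pot A v) * mpow \<N> s $ v $ j)"
    by (cases "mpow \<N> r $ i $ v"; cases "mpow \<N> s $ v $ j") simp_all
  also have "\<dots> \<le> csr_C A \<G> $ i $ p * mpow (csr_S A \<G>) t $ p $ q * csr_R A \<G> $ q $ j"
    using 1 2 by (intro rmax_mult_mono) (simp_all add: csr_S_power[OF pG] q_def)
  also have "\<dots> \<le> (csr_C A \<G> ** mpow (csr_S A \<G>) t) $ i $ q * csr_R A \<G> $ q $ j"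
    by (intro rmax_mult_mono matrix_mul_ge) simp
  also have "\<dots> \<le> csr t $ i $ j" by (rule matrix_mul_ge)
  finally show ?thesis .
qed

section \<open>The bound on the transient and the upper estimate of the CSR term\<close>

text \<open>Integers are used because the factor \<open>n - 2\<close> is negative for
  \<open>n = 1\<close>.\<close>

definition transient_bound :: "nat \<Rightarrow> bool" where
  "transient_bound t \<longleftrightarrow> int t \<ge> min (int (Wi CARD('n)))
     ((int CARD('n) - 2) * int (cr (mat_digraph A)) + int CARD('n))"

text \<open>For \<open>l < n\<close> both alternatives give \<open>(n - 2) * l + n\<close>, since
  \<open>(n - 1)^2 + 1 = (n - 2) * (n - 1) + n\<close>. For \<open>l = n \<ge> 2\<close> the second
  one gives \<open>n * (n - 1)\<close>, which is at least \<open>(n - 1)^2 + 1\<close>. For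
  \<open>n = 1\<close> the claim holds for every \<open>t\<close>.\<close>

lemma transient_bound_cycle:
  assumes t: "transient_bound t" and l: "0 < l" "l \<le> cr (mat_digraph A)" "l \<le> CARD('n)"
  shows "if l = CARD('n) \<and> l \<ge> 2 then (CARD('n) - 1) * (CARD('n) - 1) + 1 \<le> t
    else CARD('n) * l + CARD('n) \<le> t + 2 * l"
proof (cases "CARD('n) \<ge> 2")
  case True
  then obtain m where m: "CARD('n) = m + 2" by (metis le_Suc_ex add.commute)
  have Wi: "Wi CARD('n) = (m + 1) * (m + 1) + 1" by (simp add: Wi_def m power2_eq_square)
  have Y: "(int CARD('n) - 2) * int (cr (mat_digraph A)) + int CARD('n) =
    int (m * cr (mat_digraph A) + (m + 2))" by (simp add: m)
  have mono: "m * l + (m + 2) \<le> m * cr (mat_digraph A) + (m + 2)" using l(2) by simp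
  have "int (min ((m + 1) * (m + 1) + 1) (m * cr (mat_digraph A) + (m + 2))) \<le> int t"
    using t unfolding transient_bound_def Wi Y of_nat_min .
  then have "(m + 1) * (m + 1) + 1 \<le> t \<or> m * cr (mat_digraph A) + (m + 2) \<le> t"
    by (simp only: of_nat_le_iff min_le_iff_disj)
  then have t': "(m + 1) * (m + 1) + 1 \<le> t \<or> m * l + (m + 2) \<le> t"
    using mono by linarith
  show ?thesis
  proof (cases "l = CARD('n)")
    case True
    then show ?thesis using t' l m by (auto simp: algebra_simps)
  next
    case False
    then have "m * l \<le> m * (m + 1)" using l m by (intro mult_left_mono) auto
    then have "m * l + (m + 2) \<le> t" using t' by (auto simp: algebra_simps)
    then show ?thesis using False m by (auto simp: algebra_simps)
  qed
next
  case False
  have "CARD('n) > 0" by simp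
  then have "CARD('n) = 1" using False by linarith
  then show ?thesis using l by simp
qed

text \<open>A finite entry of a power of \<open>csr_S\<close> forces \<open>q\<close> to be the
  \<open>t\<close>-th successor of \<open>p\<close>, so the middle factor is dominated by a walk of
  length \<open>t\<close>. The outer factors are attained at multiples of \<gamma>, hence the total
  length is congruent to \<open>t\<close> modulo the length of the cycle through
  \<open>p\<close>.\<close>

lemma csr_le:
  assumes t: "transient_bound t"
  shows "csr t $ i $ j \<le> mpow \<N> t $ i $ j"
proof -
  obtain q where q: "csr t $ i $ j = (csr_C A \<G> ** mpow (csr_S A \<G>) t) $ i $ q * csr_R A \<G> $ q $ j"
    using matrix_mul_attained by blast
  obtain p where p: "(csr_C A \<G> ** mpow (csr_S A \<G>) t) $ i $ q = csr_C A \<G> $ i $ p * mpow (csr_S A \<G>) t $ p $ q"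
    using matrix_mul_attained by blast
  show ?thesis
  proof (cases "csr t $ i $ j = 0")
    case False
    then have pG: "p \<in> verts \<G>" and qG: "q \<in> verts \<G>"
      unfolding q p by (auto simp: csr_C_def csr_R_def split: if_splits)
    then have "q = (f ^^ t) p"
      using False unfolding q p by (auto simp: csr_S_power split: if_splits)
    then have Sle: "mpow (csr_S A \<G>) t $ p $ q \<le> mpow \<N> t $ p $ q"
      using csr_S_power[OF pG] mpow_succ_ge[OF pG] by simp
    obtain k where k: "csr_C A \<G> $ i $ p = mpow \<N> (\<gamma> * k) $ i $ p"
      using csr_M_attained pG by (auto simp: csr_C_def)
    obtain m where m: "csr_R A \<G> $ q $ j = mpow \<N> (\<gamma> * m) $ q $ j"
      using csr_M_attained qG by (auto simp: csr_R_def)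
    have "csr t $ i $ j \<le> mpow \<N> (\<gamma> * k) $ i $ p * (mpow \<N> t $ p $ q * mpow \<N> (\<gamma> * m) $ q $ j)"
      unfolding q p k m mult.assoc using Sle by (intro rmax_mult_mono) auto
    also have "\<dots> \<le> mpow \<N> (\<gamma> * k) $ i $ p * mpow \<N> (t + \<gamma> * m) $ p $ j"
      by (intro rmax_mult_mono mpow_ge) simp
    finally have via: "csr t $ i $ j \<le> mpow \<N> (\<gamma> * k) $ i $ p * mpow \<N> (t + \<gamma> * m) $ p $ j" .
    obtain S where S: "S \<in> crit_sccs A" "p \<in> fst ` set (scc_cycle A S)"
      using pG by (rule cycles_graph_vertE)
    define Z where "Z = fst ` set (scc_cycle A S)"
    define l where "l = card Z"
    have lS: "l = length (scc_cycle A S)" using scc_cycle_orbit(3)[OF S] by (simp add: l_def Z_def)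
    have l: "0 < l" "l \<le> cr (mat_digraph A)"
      unfolding lS using scc_cycle_nonempty[OF S(1)] scc_cycle_length_le_cr[OF S(1)] by simp_all
    have "l \<le> CARD('n)" unfolding l_def by (rule card_mono) auto
    note l = l this
    have ldvd: "l dvd \<gamma>" using scc_cycle_length_dvd[OF S(1)] lS by simp
    have orbit: "(f ^^ l) v = v \<and> (\<lambda>m. (f ^^ m) v) ` {0..<l} = Z \<and> v \<in> verts \<G>" if "v \<in> Z" for v
      using scc_cycle_orbit(1,2)[OF S(1), of v] that S(1) unfolding Z_def lS by (auto simp: cycles_graph_def)
    have cong: "(\<gamma> * k + (t + \<gamma> * m)) mod l = t mod l"
    proof -
      obtain h where "\<gamma> = l * h" using ldvd by blast
      then have "\<gamma> * k + (t + \<gamma> * m) = t + l * (h * k + h * m)" by (simp add: algebra_simps)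
      then show ?thesis by (simp only: mod_mult_self2)
    qed
    note tb = transient_bound_cycle[OF t l]
    show ?thesis
    proof (cases "l = CARD('n) \<and> l \<ge> 2")
      case True
      then have UN: "Z = UNIV" unfolding l_def by (intro card_subset_eq) auto
      have "\<exists>h. vwalk \<N> v v CARD('n) h UNIV \<and> 1 \<le> h" for v
      proof (intro exI conjI)
        let ?w = "\<lambda>m. (f ^^ m) v"
        have v: "?w l = v" "?w ` {0..<l} = UNIV" "v \<in> verts \<G>" using orbit[of v] UN by auto
        have "?w ` {0..<l} \<subseteq> ?w ` {0..l}" by (intro image_mono) auto
        then have "?w ` {0..l} = UNIV" using v(2) by (metis top.extremum_uniqueI)
        then show "vwalk \<N> v v CARD('n) (wwt \<N> ?w 0 l) UNIV"
          using vwalk_fun[of 0 l \<N> ?w] v(1) True by simp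
        show "1 \<le> wwt \<N> ?w 0 l" using wwt_succ[OF v(3), of l] v(1) by (simp add: one_rmax_def)
      qed
      then have "mpow \<N> (\<gamma> * k + (t + \<gamma> * m)) $ i $ j \<le> mpow \<N> t $ i $ j"
        using True tb cong by (intro N.hamiltonian_bound) auto
      then show ?thesis by (rule order_trans[OF via order_trans[OF mpow_ge]])
    next
      case False
      have "1 \<le> mpow \<N> (card Z) $ v $ v" if "v \<in> Z" for v
        using mpow_succ_ge[of v l] orbit[OF that] by (simp add: l_def one_rmax_def)
      then have "mpow \<N> (\<gamma> * k) $ i $ p * mpow \<N> (t + \<gamma> * m) $ p $ j \<le> mpow \<N> t $ i $ j"
      proof (rule N.via_bound)
        show "p \<in> Z" using S by (simp add: Z_def)
        have "CARD('n) * l + CARD('n) \<le> t + 2 * l" using tb False by (simp only: if_False)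
        then show "CARD('n) * card Z + CARD('n) \<le> t + 2 * card Z" by (simp only: l_def)
        show "(\<gamma> * k + (t + \<gamma> * m)) mod card Z = t mod card Z" using cong by (simp only: l_def)
      qed
      then show ?thesis using via by (rule order_trans[rotated])
    qed
  qed simp
qed

end

section \<open>Iterating the expansion\<close>

lemma mpow_eq_normalized:
  "mpow A t $ i $ j = Fin (max_cycle_mean A) ^ t * mpow (normalized_mat A) t $ i $ j"
proof -
  have "Fin (max_cycle_mean A) ^ t * Fin (- max_cycle_mean A) ^ t = 1"
    by (simp add: Fin_power one_rmax_def)
  then show ?thesis
    unfolding normalized_mat_def mpow_smult by (simp add: smult_mat_def mult.assoc[symmetric])
qed

definition delete_critical :: "rmax^'n^'n \<Rightarrow> rmax^'n^'n" where
  "delete_critical A = (\<chi> i j. if i \<in> verts (critical_graph A) \<or> j \<in> verts (critical_graph A)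
     then 0 else A $ i $ j)"

lemma csr_remainder_delete_critical: "csr_remainder A (delete_critical A)"
  by (auto simp: csr_remainder_def delete_critical_def)

lemma mpow_mono:
  assumes "\<And>i j. B $ i $ j \<le> A $ i $ j"
  shows "mpow B t $ i $ j \<le> mpow A t $ i $ j"
proof (induction t arbitrary: i)
  case (Suc t)
  have "B $ i $ k * mpow B t $ k $ j \<le> (A ** mpow A t) $ i $ j" for k
    using rmax_mult_mono[OF assms Suc] matrix_mul_ge order_trans by blast
  then show ?case by (simp add: matrix_mul_le_iff)
qed simp

text \<open>Only the estimate of the CSR term by the power uses the bound on \<open>t\<close>. The
  other direction splits an optimal walk at a critical node or, if it visits none, reads it in
  \<open>delete_critical A\<close>.\<close>

lemma csr_expansion:
  fixes A :: "rmax^'n^'n"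
  assumes t: "transient_bound A t"
  shows "mpow A t = csr_term (max_cycle_mean A) (csr_C A (cycles_graph A)) (csr_S A (cycles_graph A))
    (csr_R A (cycles_graph A)) t + mpow (delete_critical A) t"
proof -
  let ?l = "Fin (max_cycle_mean A)" and ?B = "delete_critical A"
  let ?T = "csr_term (max_cycle_mean A) (csr_C A (cycles_graph A)) (csr_S A (cycles_graph A))
    (csr_R A (cycles_graph A)) t"
  have T: "?T $ i $ j = ?l ^ t * (csr_C A (cycles_graph A) ** mpow (csr_S A (cycles_graph A)) t **
    csr_R A (cycles_graph A)) $ i $ j" for i j
    by (simp add: csr_term_def smult_mat_def)
  have "mpow A t $ i $ j = max (?T $ i $ j) (mpow ?B t $ i $ j)" for i j
  proof (rule antisym)
    have "?T $ i $ j \<le> mpow A t $ i $ j"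
      unfolding T mpow_eq_normalized[of A] using csr_le[OF t] by (intro rmax_mult_mono) auto
    moreover have "mpow ?B t $ i $ j \<le> mpow A t $ i $ j"
      by (rule mpow_mono) (simp add: delete_critical_def)
    ultimately show "max (?T $ i $ j) (mpow ?B t $ i $ j) \<le> mpow A t $ i $ j" by simp
  next
    show "mpow A t $ i $ j \<le> max (?T $ i $ j) (mpow ?B t $ i $ j)"
    proof (cases "mpow A t $ i $ j = 0")
      case False
      obtain w where w: "w 0 = i" "w t = j" "mpow A t $ i $ j = wwt A w 0 t"
        using ex_walk[OF False] by blast
      show ?thesis
      proof (cases "\<exists>k\<le>t. w k \<in> verts (critical_graph A)")
        case True
        then obtain k where k: "k \<le> t" "w k \<in> verts (critical_graph A)" by blast
        have "wwt A w 0 t = wwt A w 0 k * wwt A w k t" using k by (intro wwt_split) auto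
        also have "\<dots> \<le> mpow A k $ i $ w k * mpow A (t - k) $ w k $ j"
          using wwt_le_mpow[of 0 k A w] wwt_le_mpow[of k t A w] k w by (intro rmax_mult_mono) auto
        also have "\<dots> = ?l ^ (k + (t - k)) *
            (mpow (normalized_mat A) k $ i $ w k * mpow (normalized_mat A) (t - k) $ w k $ j)"
          by (subst (1 2) mpow_eq_normalized) (simp only: power_add mult_ac)
        also have "\<dots> \<le> ?T $ i $ j"
          unfolding T using csr_ge[OF k(2), of t k "t - k" i j] k(1) by (simp add: rmax_mult_mono)
        finally show ?thesis using w(3) by (simp add: le_max_iff_disj)
      next
        case False
        then have "wwt A w 0 t = wwt ?B w 0 t"
          unfolding wwt_def by (intro prod.cong) (auto simp: delete_critical_def)
        then show ?thesis using wwt_le_mpow[of 0 t ?B w] w by (simp add: le_max_iff_disj)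
      qed
    qed simp
  qed
  then show ?thesis by (simp add: vec_eq_iff plus_rmax_def)
qed

lemma weak_csr_delete_critical:
  fixes A :: "rmax^'n^'n"
  assumes "\<exists>p. mat_cycle A p"
  shows "weak_csr_expansion A (max_cycle_mean A) (csr_C A (cycles_graph A)) (csr_S A (cycles_graph A))
    (csr_R A (cycles_graph A)) (delete_critical A)"
proof -
  have "transient_bound A t" if "t \<ge> Wi CARD('n)" for t
    using that by (simp add: transient_bound_def min_le_iff_disj)
  then have "\<forall>\<^sub>F t in sequentially. mpow A t = csr_term (max_cycle_mean A) (csr_C A (cycles_graph A))
      (csr_S A (cycles_graph A)) (csr_R A (cycles_graph A)) t + mpow (delete_critical A) t"
    using csr_expansion by (intro eventually_sequentiallyI) blast
  then show ?thesis
    unfolding weak_csr_expansion_def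
    using assms representing_cycles_graph no_trivial_cycles_graph csr_remainder_delete_critical by blast
qed

lemma cycle_delete_critical: "mat_cycle (delete_critical A) p \<Longrightarrow> mat_cycle A p"
proof -
  have "subgraph (mat_digraph (delete_critical A)) (mat_digraph A)"
    by (intro subgraphI wf_mat_digraph) (auto simp: compatible_def delete_critical_def split: if_splits)
  then show "mat_cycle (delete_critical A) p \<Longrightarrow> mat_cycle A p"
    by (rule wf_digraph.subgraph_cycle[OF wf_mat_digraph])
qed

text \<open>Deleting entries can only decrease \<open>cr\<close>, and for \<open>n \<ge> 2\<close>
  its coefficient is nonnegative; for \<open>n = 1\<close> the Wielandt number is zero and every
  \<open>t\<close> qualifies.\<close>

lemma transient_bound_delete_critical:
  fixes A :: "rmax^'n^'n"
  assumes "transient_bound A t" shows "transient_bound (delete_critical A) t"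
proof (cases "CARD('n) \<ge> 2")
  case True
  have "cr (mat_digraph (delete_critical A)) \<le> cr (mat_digraph A)"
    unfolding cr_def using finite_cycles[of A] cycle_delete_critical[of A]
    by (intro Max_mono) (auto simp: setcompr_eq_image)
  then have "(int CARD('n) - 2) * int (cr (mat_digraph (delete_critical A)))
      \<le> (int CARD('n) - 2) * int (cr (mat_digraph A))"
    using True by (intro mult_left_mono) auto
  then show ?thesis using assms unfolding transient_bound_def by linarith
next
  case False
  then have "Wi CARD('n) = 0" by (simp add: Wi_def)
  then show ?thesis by (simp add: transient_bound_def min_le_iff_disj)
qed

section \<open>Termination of the iteration\<close>

text \<open>The termination measure: \<open>mat_digraph\<close> keeps all indices as nodes, so
  progress is measured by the nodes that still have an incident arc.\<close>

definition active :: "rmax^'n^'n \<Rightarrow> 'n set" where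
  "active A = {i. \<exists>j. A $ i $ j \<noteq> 0 \<or> A $ j $ i \<noteq> 0}"

lemma critical_verts_nonempty:
  assumes "mat_cycle A p" shows "verts (critical_graph A) \<noteq> {}"
proof -
  obtain q where q: "critical_cycle A q" using ex_critical_cycle[OF assms] by blast
  then have "q \<noteq> []" using cycle_fun[OF critical_cycle_imp_cycle[OF q]] by auto
  then have "fst (hd q) \<in> verts (critical_graph A)"
    using q unfolding verts_critical_graph by (metis hd_in_set imageI)
  then show ?thesis by blast
qed

lemma critical_verts_active: "verts (critical_graph A) \<subseteq> active A"
proof
  fix v assume "v \<in> verts (critical_graph A)"
  then obtain p where p: "critical_cycle A p" "v \<in> fst ` set p" unfolding verts_critical_graph by blast
  interpret wf_digraph "mat_digraph A" by (rule wf_mat_digraph)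
  have "set p \<subseteq> arcs (mat_digraph A)"
    using critical_cycle_imp_cycle[OF p(1)] by (auto simp: cycle_def awalk_def)
  then show "v \<in> active A" using p(2) by (force simp: active_def)
qed

lemma card_active_delete_critical:
  assumes "mat_cycle A p" shows "card (active (delete_critical A)) < card (active A)"
proof (rule psubset_card_mono)
  have "active (delete_critical A) \<subseteq> active A - verts (critical_graph A)"
    by (auto simp: active_def delete_critical_def split: if_splits)
  then show "active (delete_critical A) \<subset> active A"
    using critical_verts_nonempty[OF assms] critical_verts_active[of A] by blast
qed simp

text \<open>A walk with \<open>n\<close> or more steps repeats a node, and a simple closed part of a
  walk of finite weight would be a cycle.\<close>

lemma acyclic_mpow_eq_0:
  fixes A :: "rmax^'n^'n"
  assumes acyc: "\<nexists>p. mat_cycle A p" and t: "t \<ge> CARD('n)"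
  shows "mpow A t $ i $ j = 0"
proof (rule ccontr)
  assume nz: "mpow A t $ i $ j \<noteq> 0"
  obtain w where w: "mpow A t $ i $ j = wwt A w 0 t" using ex_walk[OF nz] by blast
  have "\<not> inj_on w {0..t}"
  proof
    assume "inj_on w {0..t}"
    then have "card {0..t} \<le> CARD('n)" by (rule card_inj_on_le) auto
    then show False using t by simp
  qed
  then obtain a b where ab: "a < b" "b \<le> t" "w a = w b" "inj_on w {a..<b}" by (rule closed_subwalk)
  have "wwt A w a b \<noteq> 0" using nz w ab(2) by (auto simp: wwt_neq_0_iff)
  moreover obtain v d where "0 < d" "inj_on v {0..<d}" "v d = v 0" "wwt A w a b = wwt A v 0 d"
    using simple_closed_subwalk[OF ab(1,3,4), of A] unfolding simple_closed_def by blast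
  ultimately show False using fun_cycle[of d v A] acyc by auto
qed

theorem corollary4p3:
  fixes A :: "rmax^'n^'n"
  shows "\<exists>(K :: nat) (l :: nat \<Rightarrow> real) (C :: nat \<Rightarrow> rmax^'n^'n) (S :: nat \<Rightarrow> rmax^'n^'n)
            (R :: nat \<Rightarrow> rmax^'n^'n).
     K \<le> CARD('n) \<and>
     iterated_weak_csr A K l C S R \<and>
     (\<forall>i\<in>{1..K}. \<exists>P. boolean_mat P \<and> periodic_mat P \<and> diag_similar (S i) P) \<and>
     (\<forall>t :: nat.
        int t \<ge> min (int (Wi CARD('n)))
                    ((int CARD('n) - 2) * int (cr (mat_digraph A)) + int CARD('n)) \<longrightarrow>
        (t > 0 \<or> (\<exists>p. mat_cycle A p)) \<longrightarrow>
        mpow A t = (\<Sum>i\<in>{1..K}. csr_term (l i) (C i) (S i) (R i) t))"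
proof -
  define B where "B k = (delete_critical ^^ k) A" for k
  define l where "l i = max_cycle_mean (B (i - 1))" for i
  define C where "C i = csr_C (B (i - 1)) (cycles_graph (B (i - 1)))" for i
  define S where "S i = csr_S (B (i - 1)) (cycles_graph (B (i - 1)))" for i
  define R where "R i = csr_R (B (i - 1)) (cycles_graph (B (i - 1)))" for i
  have B0: "B 0 = A" and BS: "B (Suc k) = delete_critical (B k)" for k by (simp_all add: B_def)
  have decr: "card (active (B k)) + k \<le> CARD('n)" if "\<forall>i<k. \<exists>p. mat_cycle (B i) p" for k
    using that
  proof (induction k)
    case 0
    show ?case by (simp add: card_mono)
  next
    case (Suc k)
    then obtain p where "mat_cycle (B k) p" by blast
    from card_active_delete_critical[OF this] Suc show ?case by (simp add: BS)
  qed
  define K where "K = (LEAST k. \<nexists>p. mat_cycle (B k) p)"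
  have "\<exists>k. \<nexists>p. mat_cycle (B k) p"
    \<comment> \<open>If every remainder had a cycle, this instance would give
      \<open>n + 1 \<le> n\<close>.\<close>
    using decr[of "Suc CARD('n)"] by (metis add_leD2 not_less_eq_eq order_refl)
  then have acyc: "\<nexists>p. mat_cycle (B K) p" unfolding K_def by (rule LeastI_ex)
  have cyc: "\<exists>p. mat_cycle (B k) p" if "k < K" for k
    using that not_less_Least unfolding K_def by blast
  have K: "K \<le> CARD('n)" using decr[of K] cyc by simp
  have "iterated_weak_csr A K l C S R"
    unfolding iterated_weak_csr_def
  proof (intro exI[of _ B] conjI ballI)
    fix i assume i: "i \<in> {1..K}"
    then obtain k where k: "i = Suc k" "k < K" by (cases i) auto
    then show "weak_csr_expansion (B (i - 1)) (l i) (C i) (S i) (R i) (B i)"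
      using weak_csr_delete_critical[OF cyc[OF k(2)]]
      by (simp add: l_def C_def S_def R_def BS)
  qed (use B0 acyc in auto)
  moreover have "\<exists>P. boolean_mat P \<and> periodic_mat P \<and> diag_similar (S i) P" for i
    unfolding S_def by (rule csr_S_similar_periodic)
  moreover have "mpow A t = (\<Sum>i\<in>{1..K}. csr_term (l i) (C i) (S i) (R i) t)"
    if tb: "transient_bound A t" and t: "t > 0 \<or> (\<exists>p. mat_cycle A p)" for t
  proof -
    let ?\<Sigma> = "\<lambda>k. \<Sum>i\<in>{1..k}. csr_term (l i) (C i) (S i) (R i) t"
    have tbB: "transient_bound (B k) t" for k
      by (induction k) (simp_all add: B0 BS tb transient_bound_delete_critical)
    have "mpow A t = ?\<Sigma> k + mpow (B k) t" for k
    proof (induction k)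
      case 0
      then show ?case by (simp add: B0)
    next
      case (Suc k)
      have "mpow (B k) t = csr_term (l (Suc k)) (C (Suc k)) (S (Suc k)) (R (Suc k)) t + mpow (B (Suc k)) t"
        using csr_expansion[OF tbB] by (simp add: l_def C_def S_def R_def BS)
      with Suc show ?case by (simp add: add.assoc)
    qed
    note expand = this[of K]
    \<comment> \<open>The last remainder has to be absorbed by the sum. Its power vanishes for
      \<open>t \<ge> n\<close>, and for \<open>n \<ge> 2\<close> both alternatives of the bound are
      at least \<open>n\<close>.\<close>
    have le: "mpow (B K) t $ i $ j \<le> ?\<Sigma> K $ i $ j" for i j
    proof (cases "t \<ge> CARD('n)")
      case True
      then show ?thesis using acyclic_mpow_eq_0[OF acyc] by simp
    next
      case False
      have n1: "CARD('n) = 1"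
      proof (rule ccontr)
        assume "CARD('n) \<noteq> 1"
        moreover have "CARD('n) > 0" by simp
        ultimately obtain m where m: "CARD('n) = m + 2" by (metis One_nat_def Suc_eq_plus1 add_2_eq_Suc' not_gr_zero not0_implies_Suc)
        have "int (Wi CARD('n)) \<ge> int CARD('n)" by (simp add: Wi_def m power2_eq_square)
        moreover have "(int CARD('n) - 2) * int (cr (mat_digraph A)) + int CARD('n) \<ge> int CARD('n)"
          by (simp add: m)
        ultimately show False using tb False unfolding transient_bound_def by linarith
      qed
      \<comment> \<open>This leaves \<open>n = 1\<close> and \<open>t = 0\<close>, where the power
        of the remainder is the unit matrix. By the side condition on \<open>t\<close>, the matrix
        \<open>A\<close> has a cycle, so the only node is critical and the first CSR term dominates
        the unit. Without a cycle the sum would be empty.\<close>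
      then have t0: "t = 0" and cycA: "\<exists>p. mat_cycle A p" using False t by auto
      then have "K > 0" using acyc B0 by (cases K) auto
      have "verts (critical_graph A) = UNIV"
        using critical_verts_nonempty cycA n1 by (metis card_1_singletonE subset_singletonD subset_UNIV)
      then have "mpow (normalized_mat A) 0 $ i $ i * mpow (normalized_mat A) 0 $ i $ j
          \<le> (C 1 ** mpow (S 1) 0 ** R 1) $ i $ j"
        unfolding C_def S_def R_def by (simp add: B0 csr_ge del: mpow.simps)
      then have "mpow (B K) t $ i $ j \<le> csr_term (l 1) (C 1) (S 1) (R 1) t $ i $ j"
        by (simp add: t0 mat_def csr_term_def smult_mat_def)
      also have "\<dots> \<le> (\<Sum>k\<in>{1..K}. csr_term (l k) (C k) (S k) (R k) t $ i $ j)"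
        using \<open>K > 0\<close> by (intro rmax_sum_ge[of _ 1]) auto
      finally show ?thesis by simp
    qed
    show ?thesis
    proof (simp only: vec_eq_iff, intro allI)
      fix i j
      have "mpow A t $ i $ j = max (?\<Sigma> K $ i $ j) (mpow (B K) t $ i $ j)"
        unfolding expand by (simp add: plus_rmax_def)
      then show "mpow A t $ i $ j = ?\<Sigma> K $ i $ j" using le[of i j] by (simp only: max.absorb1)
    qed
  qed
  ultimately show ?thesis using K unfolding transient_bound_def by blast
qed

end
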